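(* Let $X_1,X_2,X_3$ be Polish spaces, $\mu_i\in\mathcal{P}(X_i)$, $\mu_{ij}=\mu_i\otimes\mu_j$ for $1\le i<j\le3$, and let $c:X_1\times X_2\times X_3\to[0,\infty)$ be bounded and continuous. Then (a) there is a solution $\{f_{ij}\}$ to the relaxed dual problem with $-17\|c\|_\infty\le f_{ij}(x_i,x_j)\le 13\tfrac13\|c\|_\infty$ for all $(x_i,x_j)$; (b) there is a solution $\{f_{ij}\}$ to the standard dual problem with $-26\tfrac23\|c\|_\infty\le f_{ij}(x_i,x_j)\le 13\tfrac13\|c\|_\infty$ for all $(x_i,x_j)$.
   Context: A measurable set $A\subseteq X=X_1\times X_2\times X_3$ has zero $(3,2)$-thickness if there exist measurable $Y_{ij}\subseteq X_i\times X_j$ with $\mu_{ij}(Y_{ij})=0$ and $A\subseteq\bigcup_{i<j}\{x:(x_i,x_j)\in Y_{ij}\}$. Standard dual problem: maximize $\sum_{i<j}\int f_{ij}\,d\mu_{ij}$ over tuples $f_{ij}\in L^1(\mu_{ij})$ with $f_{12}(x_1,x_2)+f_{13}(x_1,x_3)+f_{23}(x_2,x_3)\le c(x)$ for all $x\in X$. Relaxed dual problem: the same maximization over real-valued $f_{ij}\in L^1(\mu_{ij})$ for which the inequality holds for all $x$ outside a set of zero $(3,2)$-thickness. A solution is a tuple attaining the maximum (both problems have the same supremum). *)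

theory Defs
  imports "HOL-Probability.Probability"
begin

definition sup_norm :: "('x \<Rightarrow> real) \<Rightarrow> real" where
  "sup_norm c = (SUP x. \<bar>c x\<bar>)"

definition zero_thickness ::
  "'a measure \<Rightarrow> 'b measure \<Rightarrow> 'c measure \<Rightarrow> ('a \<times> 'b \<times> 'c) set \<Rightarrow> bool" where
  "zero_thickness M1 M2 M3 A \<longleftrightarrow>
     A \<in> sets (M1 \<Otimes>\<^sub>M (M2 \<Otimes>\<^sub>M M3)) \<and>
     (\<exists>Y12 Y13 Y23.
        Y12 \<in> sets (M1 \<Otimes>\<^sub>M M2) \<and> measure (M1 \<Otimes>\<^sub>M M2) Y12 = 0 \<and>
        Y13 \<in> sets (M1 \<Otimes>\<^sub>M M3) \<and> measure (M1 \<Otimes>\<^sub>M M3) Y13 = 0 \<and>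
        Y23 \<in> sets (M2 \<Otimes>\<^sub>M M3) \<and> measure (M2 \<Otimes>\<^sub>M M3) Y23 = 0 \<and>
        A \<subseteq> {(x1, x2, x3). (x1, x2) \<in> Y12 \<or> (x1, x3) \<in> Y13 \<or> (x2, x3) \<in> Y23})"

definition dual_value ::
  "'a measure \<Rightarrow> 'b measure \<Rightarrow> 'c measure \<Rightarrow>
   ('a \<times> 'b \<Rightarrow> real) \<Rightarrow> ('a \<times> 'c \<Rightarrow> real) \<Rightarrow> ('b \<times> 'c \<Rightarrow> real) \<Rightarrow> real" where
  "dual_value M1 M2 M3 f12 f13 f23 =
     (\<integral>p. f12 p \<partial>(M1 \<Otimes>\<^sub>M M2)) + (\<integral>p. f13 p \<partial>(M1 \<Otimes>\<^sub>M M3)) + (\<integral>p. f23 p \<partial>(M2 \<Otimes>\<^sub>M M3))"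

definition std_feasible ::
  "'a measure \<Rightarrow> 'b measure \<Rightarrow> 'c measure \<Rightarrow> ('a \<times> 'b \<times> 'c \<Rightarrow> real) \<Rightarrow>
   ('a \<times> 'b \<Rightarrow> real) \<Rightarrow> ('a \<times> 'c \<Rightarrow> real) \<Rightarrow> ('b \<times> 'c \<Rightarrow> real) \<Rightarrow> bool" where
  "std_feasible M1 M2 M3 c f12 f13 f23 \<longleftrightarrow>
     integrable (M1 \<Otimes>\<^sub>M M2) f12 \<and> integrable (M1 \<Otimes>\<^sub>M M3) f13 \<and> integrable (M2 \<Otimes>\<^sub>M M3) f23 \<and>
     (\<forall>x1 x2 x3. f12 (x1, x2) + f13 (x1, x3) + f23 (x2, x3) \<le> c (x1, x2, x3))"

definition relaxed_feasible ::
  "'a measure \<Rightarrow> 'b measure \<Rightarrow> 'c measure \<Rightarrow> ('a \<times> 'b \<times> 'c \<Rightarrow> real) \<Rightarrow>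
   ('a \<times> 'b \<Rightarrow> real) \<Rightarrow> ('a \<times> 'c \<Rightarrow> real) \<Rightarrow> ('b \<times> 'c \<Rightarrow> real) \<Rightarrow> bool" where
  "relaxed_feasible M1 M2 M3 c f12 f13 f23 \<longleftrightarrow>
     integrable (M1 \<Otimes>\<^sub>M M2) f12 \<and> integrable (M1 \<Otimes>\<^sub>M M3) f13 \<and> integrable (M2 \<Otimes>\<^sub>M M3) f23 \<and>
     (\<exists>N. zero_thickness M1 M2 M3 N \<and>
        (\<forall>x1 x2 x3. (x1, x2, x3) \<notin> N \<longrightarrow> f12 (x1, x2) + f13 (x1, x3) + f23 (x2, x3) \<le> c (x1, x2, x3)))"

definition std_solution where
  "std_solution M1 M2 M3 c f12 f13 f23 \<longleftrightarrow>
     std_feasible M1 M2 M3 c f12 f13 f23 \<and>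
     (\<forall>g12 g13 g23. std_feasible M1 M2 M3 c g12 g13 g23 \<longrightarrow>
        dual_value M1 M2 M3 g12 g13 g23 \<le> dual_value M1 M2 M3 f12 f13 f23)"

definition relaxed_solution where
  "relaxed_solution M1 M2 M3 c f12 f13 f23 \<longleftrightarrow>
     relaxed_feasible M1 M2 M3 c f12 f13 f23 \<and>
     (\<forall>g12 g13 g23. relaxed_feasible M1 M2 M3 c g12 g13 g23 \<longrightarrow>
        dual_value M1 M2 M3 g12 g13 g23 \<le> dual_value M1 M2 M3 f12 f13 f23)"

end

theory Submission
  imports Defs
begin

text \<open>
  Let \<open>0 \<le> c \<le> K\<close>, let \<open>f\<close> be feasible with dual value \<open>V \<ge> 0\<close>, and let \<open>F\<close> be the sum of the
  \<open>f\<^sub>i\<^sub>j\<close>. All conditional expectations \<open>E[F | x\<^sub>i, x\<^sub>j]\<close> are at most \<open>K\<close>, and \<open>F\<close> is the sum of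
  \<open>E[F | x\<^sub>i, x\<^sub>j] - a\<^sub>i / 2 - a\<^sub>j / 2 + V / 3\<close> with \<open>a\<^sub>i = E[F | x\<^sub>i]\<close>. Where \<open>a\<^sub>i < V - K\<close>, the slice of
  \<open>f\<close> can be exchanged for a feasible one with mean value \<open>V - K\<close>; so if \<open>f\<close> is optimal up to \<open>\<epsilon>\<close>,
  replacing \<open>a\<^sub>i\<close> by \<open>max a\<^sub>i (V - K)\<close> in the decomposition lowers the dual value by at most \<open>3 \<epsilon>\<close>
  and makes every term at most \<open>2 K\<close>. Cutting off at \<open>- 4 K\<close> from below preserves feasibility.
  Hence there are maximizing sequences with values in \<open>[- 4 K, 2 K]\<close>. Near-minimizers of the
  \<open>L\<^sup>2\<close> norm among near-maximizers form, by the parallelogram law, a Cauchy sequence, and its almost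
  everywhere limit is a solution.
\<close>

section \<open>Products of two probability spaces\<close>

context pair_prob_space
begin

lemma AE_pair_prod_swap:
  assumes "AE p in M1 \<Otimes>\<^sub>M M2. P p"
  shows "AE p in M2 \<Otimes>\<^sub>M M1. P (prod.swap p)"
proof -
  have "AE p in distr (M2 \<Otimes>\<^sub>M M1) (M1 \<Otimes>\<^sub>M M2) (\<lambda>(x, y). (y, x)). P p"
    unfolding distr_pair_swap[symmetric] by (rule assms)
  from AE_distrD[OF measurable_pair_swap' this] show ?thesis
    by (simp add: prod.swap_def case_prod_beta')
qed

lemma distr_fst_pair: "distr (M1 \<Otimes>\<^sub>M M2) M1 fst = M1"
  by (rule M2.distr_pair_fst)

lemma distr_snd_pair: "distr (M1 \<Otimes>\<^sub>M M2) M2 snd = M2"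
proof -
  have "distr (M1 \<Otimes>\<^sub>M M2) M2 snd = distr (distr (M2 \<Otimes>\<^sub>M M1) (M1 \<Otimes>\<^sub>M M2) (\<lambda>(x, y). (y, x))) M2 snd"
    using distr_pair_swap by simp
  also have "\<dots> = distr (M2 \<Otimes>\<^sub>M M1) M2 fst"
    by (subst distr_distr) (auto simp: o_def case_prod_beta')
  finally show ?thesis
    by (simp add: M1.distr_pair_fst)
qed

text \<open>The first marginal of a product of probability measures is \<open>M1\<close>, so null
  sets pull back along \<open>fst\<close>. Together with the twin for \<open>snd\<close>, this lets
  conditions on slices be combined with conditions on pairs.\<close>

lemma AE_pair_fst:
  assumes "AE x in M1. P x"
  shows "AE p in M1 \<Otimes>\<^sub>M M2. P (fst p)"
proof (rule AE_distrD[where M' = M1])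
  show "AE t in distr (M1 \<Otimes>\<^sub>M M2) M1 fst. P t"
    unfolding distr_fst_pair by (rule assms)
qed simp

lemma AE_pair_snd:
  assumes "AE y in M2. P y"
  shows "AE p in M1 \<Otimes>\<^sub>M M2. P (snd p)"
proof (rule AE_distrD[where M' = M2])
  show "AE t in distr (M1 \<Otimes>\<^sub>M M2) M2 snd. P t"
    unfolding distr_snd_pair by (rule assms)
qed simp

lemma integrable_pair_prod_swap:
  fixes f :: "_ \<Rightarrow> real"
  assumes "integrable (M1 \<Otimes>\<^sub>M M2) f"
  shows "integrable (M2 \<Otimes>\<^sub>M M1) (f \<circ> prod.swap)"
  using integrable_product_swap[OF assms] by (simp add: o_def prod.swap_def case_prod_beta')

lemma integral_pair_prod_swap:
  fixes f :: "_ \<Rightarrow> real"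
  assumes "integrable (M1 \<Otimes>\<^sub>M M2) f"
  shows "integral\<^sup>L (M2 \<Otimes>\<^sub>M M1) (f \<circ> prod.swap) = integral\<^sup>L (M1 \<Otimes>\<^sub>M M2) f"
  using integral_product_swap[of f] assms by (simp add: o_def prod.swap_def case_prod_beta')

lemma
  fixes g :: "'a \<Rightarrow> real"
  assumes "integrable M1 g"
  shows integrable_pair_fst: "integrable (M1 \<Otimes>\<^sub>M M2) (\<lambda>p. g (fst p))"
    and integral_pair_fst: "(\<integral>p. g (fst p) \<partial>(M1 \<Otimes>\<^sub>M M2)) = (\<integral>x. g x \<partial>M1)"
  using integrable_distr[of fst "M1 \<Otimes>\<^sub>M M2" M1 g] integral_distr[of fst "M1 \<Otimes>\<^sub>M M2" M1 g] assms
  by (simp_all add: distr_fst_pair)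

lemma
  fixes g :: "'b \<Rightarrow> real"
  assumes "integrable M2 g"
  shows integrable_pair_snd: "integrable (M1 \<Otimes>\<^sub>M M2) (\<lambda>p. g (snd p))"
    and integral_pair_snd: "(\<integral>p. g (snd p) \<partial>(M1 \<Otimes>\<^sub>M M2)) = (\<integral>x. g x \<partial>M2)"
  using integrable_distr[of snd "M1 \<Otimes>\<^sub>M M2" M2 g] integral_distr[of snd "M1 \<Otimes>\<^sub>M M2" M2 g] assms
  by (simp_all add: distr_snd_pair)

lemma
  fixes f :: "_ \<Rightarrow> real"
  assumes "integrable (M1 \<Otimes>\<^sub>M M2) f"
  shows integrable_marginal_snd: "integrable M2 (\<lambda>y. \<integral>x. f (x, y) \<partial>M1)"
    and integral_marginal_snd: "(\<integral>y. (\<integral>x. f (x, y) \<partial>M1) \<partial>M2) = integral\<^sup>L (M1 \<Otimes>\<^sub>M M2) f"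
  using integrable_snd[of "\<lambda>x y. f (x, y)"] integral_snd[of "\<lambda>x y. f (x, y)"] assms by simp_all

end

section \<open>Feasible triples\<close>

text \<open>The relaxed constraint in a form suited to permuting the factors: exceptional sets enter
  through one almost-everywhere predicate per pair, and \<open>c\<close> is curried so that its
  arguments can be exchanged.\<close>

definition ae_feasible ::
  "'a measure \<Rightarrow> 'b measure \<Rightarrow> 'c measure \<Rightarrow> ('a \<Rightarrow> 'b \<Rightarrow> 'c \<Rightarrow> real) \<Rightarrow>
   ('a \<times> 'b \<Rightarrow> real) \<Rightarrow> ('a \<times> 'c \<Rightarrow> real) \<Rightarrow> ('b \<times> 'c \<Rightarrow> real) \<Rightarrow> bool" where
  "ae_feasible M1 M2 M3 c f12 f13 f23 \<longleftrightarrow>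
     integrable (M1 \<Otimes>\<^sub>M M2) f12 \<and> integrable (M1 \<Otimes>\<^sub>M M3) f13 \<and> integrable (M2 \<Otimes>\<^sub>M M3) f23 \<and>
     (\<exists>P12 P13 P23. (AE p in M1 \<Otimes>\<^sub>M M2. P12 p) \<and> (AE p in M1 \<Otimes>\<^sub>M M3. P13 p) \<and>
        (AE p in M2 \<Otimes>\<^sub>M M3. P23 p) \<and>
        (\<forall>x y z. P12 (x, y) \<longrightarrow> P13 (x, z) \<longrightarrow> P23 (y, z) \<longrightarrow>
           f12 (x, y) + f13 (x, z) + f23 (y, z) \<le> c x y z))"

locale three_prob_spaces = P1: prob_space M1 + P2: prob_space M2 + P3: prob_space M3
  for M1 :: "'a measure" and M2 :: "'b measure" and M3 :: "'c measure"
begin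

sublocale P12: pair_prob_space M1 M2 ..
sublocale P13: pair_prob_space M1 M3 ..
sublocale P23: pair_prob_space M2 M3 ..

lemma ae_feasibleI:
  assumes "integrable (M1 \<Otimes>\<^sub>M M2) f12" "integrable (M1 \<Otimes>\<^sub>M M3) f13" "integrable (M2 \<Otimes>\<^sub>M M3) f23"
    and "AE p in M1 \<Otimes>\<^sub>M M2. P12 p" "AE p in M1 \<Otimes>\<^sub>M M3. P13 p" "AE p in M2 \<Otimes>\<^sub>M M3. P23 p"
    and "\<And>x y z. P12 (x, y) \<Longrightarrow> P13 (x, z) \<Longrightarrow> P23 (y, z) \<Longrightarrow>
      f12 (x, y) + f13 (x, z) + f23 (y, z) \<le> c x y z"
  shows "ae_feasible M1 M2 M3 c f12 f13 f23"
  unfolding ae_feasible_def using assms by blast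

lemma ae_feasibleE:
  assumes "ae_feasible M1 M2 M3 c f12 f13 f23"
  obtains P12 P13 P23 where
    "AE p in M1 \<Otimes>\<^sub>M M2. P12 p" "AE p in M1 \<Otimes>\<^sub>M M3. P13 p" "AE p in M2 \<Otimes>\<^sub>M M3. P23 p"
    "\<And>x y z. P12 (x, y) \<Longrightarrow> P13 (x, z) \<Longrightarrow> P23 (y, z) \<Longrightarrow>
      f12 (x, y) + f13 (x, z) + f23 (y, z) \<le> c x y z"
  using assms unfolding ae_feasible_def by blast

lemma ae_feasible_integrable:
  assumes "ae_feasible M1 M2 M3 c f12 f13 f23"
  shows "integrable (M1 \<Otimes>\<^sub>M M2) f12" "integrable (M1 \<Otimes>\<^sub>M M3) f13" "integrable (M2 \<Otimes>\<^sub>M M3) f23"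
  using assms unfolding ae_feasible_def by blast+

section \<open>Symmetry under permutations of the three factors\<close>

text \<open>The transpositions 12 and 23 generate all permutations, so a statement proved for one
  pair or one coordinate carries over to the others. Each reverses the order within one pair only,
  hence a single \<open>prod.swap\<close>.\<close>

lemma ae_feasible_swap12:
  assumes "ae_feasible M1 M2 M3 c f12 f13 f23"
  shows "ae_feasible M2 M1 M3 (\<lambda>y x z. c x y z) (f12 \<circ> prod.swap) f23 f13"
proof -
  interpret S: three_prob_spaces M2 M1 M3 ..
  note i = ae_feasible_integrable[OF assms]
  from assms obtain P12 P13 P23 where P:
    "AE p in M1 \<Otimes>\<^sub>M M2. P12 p" "AE p in M1 \<Otimes>\<^sub>M M3. P13 p" "AE p in M2 \<Otimes>\<^sub>M M3. P23 p"
    "\<And>x y z. P12 (x, y) \<Longrightarrow> P13 (x, z) \<Longrightarrow> P23 (y, z) \<Longrightarrow>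
      f12 (x, y) + f13 (x, z) + f23 (y, z) \<le> c x y z"
    by (elim ae_feasibleE) blast
  show ?thesis
    by (rule S.ae_feasibleI[OF P12.integrable_pair_prod_swap[OF i(1)] i(3,2)
          P12.AE_pair_prod_swap[OF P(1)] P(3,2)])
       (use P(4) in \<open>simp add: add.commute add.left_commute\<close>)
qed

lemma ae_feasible_swap23:
  assumes "ae_feasible M1 M2 M3 c f12 f13 f23"
  shows "ae_feasible M1 M3 M2 (\<lambda>x z y. c x y z) f13 f12 (f23 \<circ> prod.swap)"
proof -
  interpret S: three_prob_spaces M1 M3 M2 ..
  note i = ae_feasible_integrable[OF assms]
  from assms obtain P12 P13 P23 where P:
    "AE p in M1 \<Otimes>\<^sub>M M2. P12 p" "AE p in M1 \<Otimes>\<^sub>M M3. P13 p" "AE p in M2 \<Otimes>\<^sub>M M3. P23 p"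
    "\<And>x y z. P12 (x, y) \<Longrightarrow> P13 (x, z) \<Longrightarrow> P23 (y, z) \<Longrightarrow>
      f12 (x, y) + f13 (x, z) + f23 (y, z) \<le> c x y z"
    by (elim ae_feasibleE) blast
  show ?thesis
    by (rule S.ae_feasibleI[OF i(2,1) P23.integrable_pair_prod_swap[OF i(3)]
          P(2,1) P23.AE_pair_prod_swap[OF P(3)]])
       (use P(4) in \<open>simp add: add.commute add.left_commute\<close>)
qed

lemma dual_value_swap12:
  assumes "integrable (M1 \<Otimes>\<^sub>M M2) f12"
  shows "dual_value M2 M1 M3 (f12 \<circ> prod.swap) f23 f13 = dual_value M1 M2 M3 f12 f13 f23"
  unfolding dual_value_def P12.integral_pair_prod_swap[OF assms] by simp

lemma dual_value_swap23:
  assumes "integrable (M2 \<Otimes>\<^sub>M M3) f23"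
  shows "dual_value M1 M3 M2 f13 f12 (f23 \<circ> prod.swap) = dual_value M1 M2 M3 f12 f13 f23"
  unfolding dual_value_def P23.integral_pair_prod_swap[OF assms] by simp

section \<open>Bounds on conditional means and exchange of slices\<close>

text \<open>Integrate the constraint over \<open>z\<close>. By Fubini, for almost every
  \<open>(x, y)\<close> it holds for almost every \<open>z\<close> and both slices are integrable.
  The left side is \<open>E[F | x, y]\<close>.\<close>

lemma conditional_sum12_le:
  assumes f: "ae_feasible M1 M2 M3 c f12 f13 f23" and c: "\<And>x y z. c x y z \<le> K"
  shows "AE p in M1 \<Otimes>\<^sub>M M2.
    f12 p + (\<integral>z. f13 (fst p, z) \<partial>M3) + (\<integral>z. f23 (snd p, z) \<partial>M3) \<le> K"
proof -
  note i = ae_feasible_integrable[OF f]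
  from f obtain P12 P13 P23 where P:
    "AE p in M1 \<Otimes>\<^sub>M M2. P12 p" "AE p in M1 \<Otimes>\<^sub>M M3. P13 p" "AE p in M2 \<Otimes>\<^sub>M M3. P23 p"
    "\<And>x y z. P12 (x, y) \<Longrightarrow> P13 (x, z) \<Longrightarrow> P23 (y, z) \<Longrightarrow>
      f12 (x, y) + f13 (x, z) + f23 (y, z) \<le> c x y z"
    by (elim ae_feasibleE) blast
  show ?thesis
    using P(1) P12.AE_pair_fst[OF P13.AE_pair[OF P(2)]] P12.AE_pair_snd[OF P23.AE_pair[OF P(3)]]
      P12.AE_pair_fst[OF P13.AE_integrable_fst'[OF i(2)]]
      P12.AE_pair_snd[OF P23.AE_integrable_fst'[OF i(3)]]
  proof eventually_elim
    case (elim p)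
    obtain x y where p: "p = (x, y)"
      by fastforce
    have "AE z in M3. f12 (x, y) + f13 (x, z) + f23 (y, z) \<le> K"
      using elim(2,3)
    proof eventually_elim
      case (elim z)
      then show ?case
        using P(4)[of x y z] c[of x y z] \<open>P12 p\<close> by (simp add: p)
    qed
    moreover have i: "integrable M3 (\<lambda>z. f13 (x, z))" "integrable M3 (\<lambda>z. f23 (y, z))"
      using elim(4,5) by (simp_all add: p)
    ultimately have "(\<integral>z. f12 (x, y) + f13 (x, z) + f23 (y, z) \<partial>M3) \<le> K"
      by (intro P3.integral_le_const) auto
    with i show ?case
      by (simp add: p P3.prob_space)
  qed
qed

lemma conditional_sum13_le:
  assumes f: "ae_feasible M1 M2 M3 c f12 f13 f23" and c: "\<And>x y z. c x y z \<le> K"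
  shows "AE p in M1 \<Otimes>\<^sub>M M3.
    f13 p + (\<integral>y. f12 (fst p, y) \<partial>M2) + (\<integral>y. f23 (y, snd p) \<partial>M2) \<le> K"
proof -
  interpret S: three_prob_spaces M1 M3 M2 ..
  show ?thesis
    using S.conditional_sum12_le[OF ae_feasible_swap23[OF f], of K] c by (simp add: o_def)
qed

lemma conditional_sum23_le:
  assumes f: "ae_feasible M1 M2 M3 c f12 f13 f23" and c: "\<And>x y z. c x y z \<le> K"
  shows "AE p in M2 \<Otimes>\<^sub>M M3.
    f23 p + (\<integral>x. f12 (x, fst p) \<partial>M1) + (\<integral>x. f13 (x, snd p) \<partial>M1) \<le> K"
proof -
  interpret S: three_prob_spaces M2 M1 M3 ..
  show ?thesis
    using S.conditional_sum13_le[OF ae_feasible_swap12[OF f], of K] c by (simp add: o_def)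
qed

text \<open>Averaging \<open>E[F | x, y]\<close> over \<open>(x, y)\<close> gives the dual value.
  This makes the supremum of the problem finite.\<close>

lemma dual_value_le:
  assumes f: "ae_feasible M1 M2 M3 c f12 f13 f23" and c: "\<And>x y z. c x y z \<le> K"
  shows "dual_value M1 M2 M3 f12 f13 f23 \<le> K"
proof -
  note i = ae_feasible_integrable[OF f]
  note j = P13.integrable_fst'[OF i(2)] P23.integrable_fst'[OF i(3)]
  note j' = P12.integrable_pair_fst[OF j(1)] P12.integrable_pair_snd[OF j(2)]
  have "(\<integral>p. f12 p + (\<integral>z. f13 (fst p, z) \<partial>M3) + (\<integral>z. f23 (snd p, z) \<partial>M3) \<partial>(M1 \<Otimes>\<^sub>M M2)) \<le> K"
    using i(1) j' conditional_sum12_le[OF f c] by (intro P12.integral_le_const) auto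
  then show ?thesis
    using i(1) j' by (simp add: dual_value_def P12.integral_pair_fst[OF j(1)]
      P12.integral_pair_snd[OF j(2)] P13.integral_fst'[OF i(2)] P23.integral_fst'[OF i(3)])
qed

text \<open>On the set of those \<open>x\<close> whose slice has mean value below \<open>V - K\<close>, where \<open>V\<close> is the dual
  value, \<open>f12 (x, -)\<close> and \<open>f13 (x, -)\<close> are replaced by their averages over \<open>x\<close>, lowered by \<open>K\<close> in
  total. Since \<open>c \<ge> 0\<close>, the constraint survives, and the slice gets mean value \<open>V - K\<close>.\<close>

lemma improve_slices1:
  fixes f12 f13 f23
  defines "V \<equiv> dual_value M1 M2 M3 f12 f13 f23"
  defines "a \<equiv> \<lambda>x. (\<integral>y. f12 (x, y) \<partial>M2) + (\<integral>z. f13 (x, z) \<partial>M3) + (\<integral>p. f23 p \<partial>(M2 \<Otimes>\<^sub>M M3))"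
  assumes f: "ae_feasible M1 M2 M3 c f12 f13 f23"
    and c: "\<And>x y z. c x y z \<le> K" "\<And>x y z. 0 \<le> c x y z"
  shows "\<exists>g12 g13 g23. ae_feasible M1 M2 M3 c g12 g13 g23 \<and>
    dual_value M1 M2 M3 g12 g13 g23 = (\<integral>x. max (a x) (V - K) \<partial>M1)"
proof -
  note i = ae_feasible_integrable[OF f]
  note [measurable] = borel_measurable_integrable[OF i(1)] borel_measurable_integrable[OF i(2)]
  define q12 where "q12 y = (\<integral>x. f12 (x, y) \<partial>M1)" for y
  define q13 where "q13 z = (\<integral>x. f13 (x, z) \<partial>M1)" for z
  define p12 where "p12 x = (\<integral>y. f12 (x, y) \<partial>M2)" for x
  define p13 where "p13 x = (\<integral>z. f13 (x, z) \<partial>M3)" for x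
  have q: "integrable M2 q12" "integrable M3 q13"
    unfolding q12_def q13_def
    using P12.integrable_marginal_snd[OF i(1)] P13.integrable_marginal_snd[OF i(2)] by auto
  have Iq: "(\<integral>y. q12 y \<partial>M2) = integral\<^sup>L (M1 \<Otimes>\<^sub>M M2) f12" "(\<integral>z. q13 z \<partial>M3) = integral\<^sup>L (M1 \<Otimes>\<^sub>M M3) f13"
    unfolding q12_def q13_def
    using P12.integral_marginal_snd[OF i(1)] P13.integral_marginal_snd[OF i(2)] by auto
  have p: "integrable M1 p12" "integrable M1 p13"
    unfolding p12_def p13_def using P12.integrable_fst'[OF i(1)] P13.integrable_fst'[OF i(2)] by auto
  note [measurable] = borel_measurable_integrable[OF p(1)] borel_measurable_integrable[OF p(2)]
    borel_measurable_integrable[OF q(1)] borel_measurable_integrable[OF q(2)]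
  have a_eq: "a x = p12 x + p13 x + (\<integral>p. f23 p \<partial>(M2 \<Otimes>\<^sub>M M3))" for x
    by (simp add: a_def p12_def p13_def)
  define B where "B x \<longleftrightarrow> a x < V - K" for x
  have [measurable]: "Measurable.pred M1 B"
    unfolding B_def a_eq by measurable
  define g12 where "g12 p = (if B (fst p) then q12 (snd p) - K else f12 p)" for p
  define g13 where "g13 p = (if B (fst p) then q13 (snd p) else f13 p)" for p
  have g: "integrable (M1 \<Otimes>\<^sub>M M2) g12" "integrable (M1 \<Otimes>\<^sub>M M3) g13"
  proof -
    show "integrable (M1 \<Otimes>\<^sub>M M2) g12"
    proof (rule Bochner_Integration.integrable_bound)
      show "integrable (M1 \<Otimes>\<^sub>M M2) (\<lambda>p. \<bar>q12 (snd p)\<bar> + \<bar>K\<bar> + \<bar>f12 p\<bar>)"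
        using P12.integrable_pair_snd[OF q(1)] i(1) by auto
    qed (auto simp: g12_def[abs_def])
    show "integrable (M1 \<Otimes>\<^sub>M M3) g13"
    proof (rule Bochner_Integration.integrable_bound)
      show "integrable (M1 \<Otimes>\<^sub>M M3) (\<lambda>p. \<bar>q13 (snd p)\<bar> + \<bar>f13 p\<bar>)"
        using P13.integrable_pair_snd[OF q(2)] i(2) by auto
    qed (auto simp: g13_def[abs_def])
  qed
  from f obtain P12 P13 P23 where P:
    "AE p in M1 \<Otimes>\<^sub>M M2. P12 p" "AE p in M1 \<Otimes>\<^sub>M M3. P13 p" "AE p in M2 \<Otimes>\<^sub>M M3. P23 p"
    "\<And>x y z. P12 (x, y) \<Longrightarrow> P13 (x, z) \<Longrightarrow> P23 (y, z) \<Longrightarrow>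
      f12 (x, y) + f13 (x, z) + f23 (y, z) \<le> c x y z"
    by (elim ae_feasibleE) blast
  have "ae_feasible M1 M2 M3 c g12 g13 f23"
  proof (rule ae_feasibleI[OF g i(3) P(1,2)])
    \<comment> \<open>The bound on \<open>E[F | y, z]\<close> joins the exceptional conditions: on
      \<open>B\<close> the new sum is \<open>q12 y - K + q13 z + f23 (y, z)\<close>, which is then
      at most \<open>0\<close>, hence at most \<open>c\<close>.\<close>
    show "AE p in M2 \<Otimes>\<^sub>M M3. P23 p \<and> f23 p + q12 (fst p) + q13 (snd p) \<le> K"
      using P(3) conditional_sum23_le[OF f c(1)] by (auto simp: q12_def q13_def)
  next
    fix x y z
    assume "P12 (x, y)" "P13 (x, z)" "P23 (y, z) \<and> f23 (y, z) + q12 (fst (y, z)) + q13 (snd (y, z)) \<le> K"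
    then show "g12 (x, y) + g13 (x, z) + f23 (y, z) \<le> c x y z"
      using P(4)[of x y z] c(2)[of x y z] by (auto simp: g12_def g13_def)
  qed
  moreover have "dual_value M1 M2 M3 g12 g13 f23 = (\<integral>x. max (a x) (V - K) \<partial>M1)"
  proof -
    have 12: "(\<integral>y. g12 (x, y) \<partial>M2) =
      (if B x then integral\<^sup>L (M1 \<Otimes>\<^sub>M M2) f12 - K else p12 x)" for x
      using q by (simp add: g12_def p12_def Iq P2.prob_space)
    have 13: "(\<integral>z. g13 (x, z) \<partial>M3) =
      (if B x then integral\<^sup>L (M1 \<Otimes>\<^sub>M M3) f13 else p13 x)" for x
      by (simp add: g13_def p13_def Iq)
    have "dual_value M1 M2 M3 g12 g13 f23 =
      (\<integral>x. (\<integral>y. g12 (x, y) \<partial>M2) + (\<integral>z. g13 (x, z) \<partial>M3) + (\<integral>p. f23 p \<partial>(M2 \<Otimes>\<^sub>M M3)) \<partial>M1)"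
      using P12.integrable_fst'[OF g(1)] P13.integrable_fst'[OF g(2)]
      by (simp add: dual_value_def P12.integral_fst'[OF g(1)] P13.integral_fst'[OF g(2)] P1.prob_space)
    \<comment> \<open>On \<open>B\<close> the three means add up to \<open>V - K\<close>, which
      exceeds \<open>a x\<close>; off \<open>B\<close> the mean is still \<open>a x\<close>, which
      is at least \<open>V - K\<close>.\<close>
    also have "\<dots> = (\<integral>x. max (a x) (V - K) \<partial>M1)"
      unfolding 12 13
      by (intro Bochner_Integration.integral_cong) (auto simp: a_eq B_def V_def dual_value_def)
    finally show ?thesis .
  qed
  ultimately show ?thesis
    by blast
qed

text \<open>The first two factors are exchanged twice: once to apply the case of the first
  coordinate, once to bring the new triple back.\<close>

lemma improve_slices2:
  fixes f12 f13 f23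
  defines "V \<equiv> dual_value M1 M2 M3 f12 f13 f23"
  defines "a \<equiv> \<lambda>y. (\<integral>x. f12 (x, y) \<partial>M1) + (\<integral>z. f23 (y, z) \<partial>M3) + (\<integral>p. f13 p \<partial>(M1 \<Otimes>\<^sub>M M3))"
  assumes f: "ae_feasible M1 M2 M3 c f12 f13 f23"
    and c: "\<And>x y z. c x y z \<le> K" "\<And>x y z. 0 \<le> c x y z"
  shows "\<exists>g12 g13 g23. ae_feasible M1 M2 M3 c g12 g13 g23 \<and>
    dual_value M1 M2 M3 g12 g13 g23 = (\<integral>y. max (a y) (V - K) \<partial>M2)"
proof -
  interpret S: three_prob_spaces M2 M1 M3 ..
  obtain g12 g13 g23 where g: "ae_feasible M2 M1 M3 (\<lambda>y x z. c x y z) g12 g13 g23"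
    "dual_value M2 M1 M3 g12 g13 g23 = (\<integral>y. max (a y) (V - K) \<partial>M2)"
    using S.improve_slices1[OF ae_feasible_swap12[OF f], of K] c
      dual_value_swap12[OF ae_feasible_integrable(1)[OF f]]
    by (auto simp: a_def V_def)
  show ?thesis
    using S.ae_feasible_swap12[OF g(1)] g(2)
      S.dual_value_swap12[OF S.ae_feasible_integrable(1)[OF g(1)]] by metis
qed

lemma improve_slices3:
  fixes f12 f13 f23
  defines "V \<equiv> dual_value M1 M2 M3 f12 f13 f23"
  defines "a \<equiv> \<lambda>z. (\<integral>x. f13 (x, z) \<partial>M1) + (\<integral>y. f23 (y, z) \<partial>M2) + (\<integral>p. f12 p \<partial>(M1 \<Otimes>\<^sub>M M2))"
  assumes f: "ae_feasible M1 M2 M3 c f12 f13 f23"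
    and c: "\<And>x y z. c x y z \<le> K" "\<And>x y z. 0 \<le> c x y z"
  shows "\<exists>g12 g13 g23. ae_feasible M1 M2 M3 c g12 g13 g23 \<and>
    dual_value M1 M2 M3 g12 g13 g23 = (\<integral>z. max (a z) (V - K) \<partial>M3)"
proof -
  interpret S: three_prob_spaces M1 M3 M2 ..
  obtain g12 g13 g23 where g: "ae_feasible M1 M3 M2 (\<lambda>x z y. c x y z) g12 g13 g23"
    "dual_value M1 M3 M2 g12 g13 g23 = (\<integral>z. max (a z) (V - K) \<partial>M3)"
    using S.improve_slices2[OF ae_feasible_swap23[OF f], of K] c
      dual_value_swap23[OF ae_feasible_integrable(3)[OF f]]
    by (auto simp: a_def V_def)
  show ?thesis
    using S.ae_feasible_swap23[OF g(1)] g(2)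
      S.dual_value_swap23[OF S.ae_feasible_integrable(3)[OF g(1)]] by metis
qed


section \<open>Bounded near-maximizers\<close>

text \<open>Here \<open>S\<close> is any upper bound of the dual values. If the given value exceeds
  \<open>S - \<epsilon>\<close>, the guaranteed one exceeds \<open>S - 4 * \<epsilon>\<close>, so
  near-maximality survives up to a factor 4.\<close>

lemma bounded_improvement:
  assumes f: "ae_feasible M1 M2 M3 c f12 f13 f23"
    and c: "\<And>x y z. c x y z \<le> K" "\<And>x y z. 0 \<le> c x y z"
    and S: "\<And>g12 g13 g23. ae_feasible M1 M2 M3 c g12 g13 g23 \<Longrightarrow> dual_value M1 M2 M3 g12 g13 g23 \<le> S"
    and nonneg: "0 \<le> dual_value M1 M2 M3 f12 f13 f23"
  shows "\<exists>h12 h13 h23. ae_feasible M1 M2 M3 c h12 h13 h23 \<and>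
    range h12 \<subseteq> {- 4 * K..2 * K} \<and> range h13 \<subseteq> {- 4 * K..2 * K} \<and> range h23 \<subseteq> {- 4 * K..2 * K} \<and>
    4 * dual_value M1 M2 M3 f12 f13 f23 - 3 * S \<le> dual_value M1 M2 M3 h12 h13 h23"
proof -
  note i = ae_feasible_integrable[OF f]
  have K: "0 \<le> K"
    using c order_trans by blast
  define V where "V = dual_value M1 M2 M3 f12 f13 f23"
  define I12 where "I12 = integral\<^sup>L (M1 \<Otimes>\<^sub>M M2) f12"
  define I13 where "I13 = integral\<^sup>L (M1 \<Otimes>\<^sub>M M3) f13"
  define I23 where "I23 = integral\<^sup>L (M2 \<Otimes>\<^sub>M M3) f23"
  have V: "V = I12 + I13 + I23"
    by (simp add: V_def dual_value_def I12_def I13_def I23_def)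
  \<comment> \<open>Partial means: the \<open>p\<close> functions integrate out the second variable
    of a pair, the \<open>q\<close> functions the first. Thus \<open>E[F | x, y]\<close> is
    \<open>f12 (x, y) + p13 x + p23 y\<close>.\<close>
  define p12 where "p12 x = (\<integral>y. f12 (x, y) \<partial>M2)" for x
  define p13 where "p13 x = (\<integral>z. f13 (x, z) \<partial>M3)" for x
  define p23 where "p23 y = (\<integral>z. f23 (y, z) \<partial>M3)" for y
  define q12 where "q12 y = (\<integral>x. f12 (x, y) \<partial>M1)" for y
  define q13 where "q13 z = (\<integral>x. f13 (x, z) \<partial>M1)" for z
  define q23 where "q23 z = (\<integral>y. f23 (y, z) \<partial>M2)" for z
  have int: "integrable M1 p12" "integrable M1 p13" "integrable M2 p23"
    "integrable M2 q12" "integrable M3 q13" "integrable M3 q23"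
    unfolding p12_def p13_def p23_def q12_def q13_def q23_def
    using i by (auto intro: P12.integrable_fst' P13.integrable_fst' P23.integrable_fst'
        P12.integrable_marginal_snd P13.integrable_marginal_snd P23.integrable_marginal_snd)
  have I: "(\<integral>x. p12 x \<partial>M1) = I12" "(\<integral>x. p13 x \<partial>M1) = I13" "(\<integral>x. p23 x \<partial>M2) = I23"
    "(\<integral>x. q12 x \<partial>M2) = I12" "(\<integral>x. q13 x \<partial>M3) = I13" "(\<integral>x. q23 x \<partial>M3) = I23"
    unfolding p12_def p13_def p23_def q12_def q13_def q23_def I12_def I13_def I23_def
    using i by (simp_all add: P12.integral_fst' P13.integral_fst' P23.integral_fst'
        P12.integral_marginal_snd P13.integral_marginal_snd P23.integral_marginal_snd)
  define m1 where "m1 x = max (p12 x + p13 x + I23) (V - K)" for x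
  define m2 where "m2 y = max (q12 y + p23 y + I13) (V - K)" for y
  define m3 where "m3 z = max (q13 z + q23 z + I12) (V - K)" for z
  have m: "integrable M1 m1" "integrable M2 m2" "integrable M3 m3"
    unfolding m1_def m2_def m3_def using int by auto
  have m_eq: "m1 = (\<lambda>x. max ((\<integral>y. f12 (x, y) \<partial>M2) + (\<integral>z. f13 (x, z) \<partial>M3) + I23) (V - K))"
    "m2 = (\<lambda>y. max ((\<integral>x. f12 (x, y) \<partial>M1) + (\<integral>z. f23 (y, z) \<partial>M3) + I13) (V - K))"
    "m3 = (\<lambda>z. max ((\<integral>x. f13 (x, z) \<partial>M1) + (\<integral>y. f23 (y, z) \<partial>M2) + I12) (V - K))"
    by (simp_all add: fun_eq_iff m1_def m2_def m3_def p12_def p13_def p23_def q12_def q13_def q23_def)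
  \<comment> \<open>Each of these integrals is the dual value of the feasible triple obtained by
    exchanging slices.\<close>
  have Im: "(\<integral>x. m1 x \<partial>M1) \<le> S" "(\<integral>x. m2 x \<partial>M2) \<le> S" "(\<integral>x. m3 x \<partial>M3) \<le> S"
  proof -
    show "(\<integral>x. m1 x \<partial>M1) \<le> S"
      using improve_slices1[OF f c] unfolding m_eq V_def I23_def
      by (elim exE conjE) (drule S, simp)
    show "(\<integral>x. m2 x \<partial>M2) \<le> S"
      using improve_slices2[OF f c] unfolding m_eq V_def I13_def
      by (elim exE conjE) (drule S, simp)
    show "(\<integral>x. m3 x \<partial>M3) \<le> S"
      using improve_slices3[OF f c] unfolding m_eq V_def I12_def
      by (elim exE conjE) (drule S, simp)
  qed
  define e12 where "e12 p = f12 p + p13 (fst p) + p23 (snd p) - m1 (fst p) / 2 - m2 (snd p) / 2 + V / 3" for p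
  define e13 where "e13 p = f13 p + p12 (fst p) + q23 (snd p) - m1 (fst p) / 2 - m3 (snd p) / 2 + V / 3" for p
  define e23 where "e23 p = f23 p + q12 (fst p) + q13 (snd p) - m2 (fst p) / 2 - m3 (snd p) / 2 + V / 3" for p
  note pair_int = i P12.integrable_pair_fst P12.integrable_pair_snd P13.integrable_pair_fst
    P13.integrable_pair_snd P23.integrable_pair_fst P23.integrable_pair_snd int m
  note pair_I = P12.integral_pair_fst P12.integral_pair_snd P13.integral_pair_fst
    P13.integral_pair_snd P23.integral_pair_fst P23.integral_pair_snd I
  have e: "integrable (M1 \<Otimes>\<^sub>M M2) e12" "integrable (M1 \<Otimes>\<^sub>M M3) e13" "integrable (M2 \<Otimes>\<^sub>M M3) e23"
    unfolding e12_def e13_def e23_def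
    by (intro Bochner_Integration.integrable_add Bochner_Integration.integrable_diff
      integrable_divide pair_int P12.integrable_const P13.integrable_const P23.integrable_const)+
  \<comment> \<open>The three conditional means contribute \<open>3 * V\<close> and the shares
    \<open>V / 3\<close> one more \<open>V\<close>; every \<open>m\<close> occurs in two terms with
    weight one half.\<close>
  have e_val: "dual_value M1 M2 M3 e12 e13 e23 =
      4 * V - (\<integral>x. m1 x \<partial>M1) - (\<integral>x. m2 x \<partial>M2) - (\<integral>x. m3 x \<partial>M3)"
  proof -
    have "integral\<^sup>L (M1 \<Otimes>\<^sub>M M2) e12 = I12 + I13 + I23 - (\<integral>x. m1 x \<partial>M1) / 2 - (\<integral>x. m2 x \<partial>M2) / 2 + V / 3"
      unfolding e12_def using pair_int by (simp add: pair_I P12.prob_space I12_def[symmetric])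
    moreover have "integral\<^sup>L (M1 \<Otimes>\<^sub>M M3) e13 = I12 + I13 + I23 - (\<integral>x. m1 x \<partial>M1) / 2 - (\<integral>x. m3 x \<partial>M3) / 2 + V / 3"
      unfolding e13_def using pair_int by (simp add: pair_I P13.prob_space I13_def[symmetric])
    moreover have "integral\<^sup>L (M2 \<Otimes>\<^sub>M M3) e23 = I12 + I13 + I23 - (\<integral>x. m2 x \<partial>M2) / 2 - (\<integral>x. m3 x \<partial>M3) / 2 + V / 3"
      unfolding e23_def using pair_int by (simp add: pair_I P23.prob_space I23_def[symmetric])
    ultimately show ?thesis
      unfolding dual_value_def using V by linarith
  qed
  have m_ge: "V - K \<le> m1 x" "V - K \<le> m2 y" "V - K \<le> m3 z" for x y z
    by (simp_all add: m1_def m2_def m3_def)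
  have e_le: "AE p in M1 \<Otimes>\<^sub>M M2. e12 p \<le> 2 * K" "AE p in M1 \<Otimes>\<^sub>M M3. e13 p \<le> 2 * K"
    "AE p in M2 \<Otimes>\<^sub>M M3. e23 p \<le> 2 * K"
  proof -
    \<comment> \<open>The left side is at most
      \<open>K - (V - K) + V / 3 = 2 * K - 2 * V / 3\<close>, and \<open>V\<close> is
      nonnegative.\<close>
    have *: "s - a / 2 - b / 2 + V / 3 \<le> 2 * K" if "s \<le> K" "V - K \<le> a" "V - K \<le> b" for s a b
      using that nonneg unfolding V_def[symmetric] by (simp add: field_simps)
    show "AE p in M1 \<Otimes>\<^sub>M M2. e12 p \<le> 2 * K"
      using conditional_sum12_le[OF f c(1)]
      by eventually_elim (auto simp: e12_def p13_def p23_def intro!: * m_ge)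
    show "AE p in M1 \<Otimes>\<^sub>M M3. e13 p \<le> 2 * K"
      using conditional_sum13_le[OF f c(1)]
      by eventually_elim (auto simp: e13_def p12_def q23_def intro!: * m_ge)
    show "AE p in M2 \<Otimes>\<^sub>M M3. e23 p \<le> 2 * K"
      using conditional_sum23_le[OF f c(1)]
      by eventually_elim (auto simp: e23_def q12_def q13_def intro!: * m_ge)
  qed
  \<comment> \<open>The lower cut is minus twice the upper one: if one term is cut from below, the
    sum of the three is at most \<open>0\<close>, hence at most \<open>c\<close>. The upper cut acts
    only on null sets, but makes the bound hold at every point.\<close>
  define clamp where "clamp t = max (- 4 * K) (min (2 * K) t)" for t
  have h: "integrable (M1 \<Otimes>\<^sub>M M2) (\<lambda>p. clamp (e12 p))" "integrable (M1 \<Otimes>\<^sub>M M3) (\<lambda>p. clamp (e13 p))"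
    "integrable (M2 \<Otimes>\<^sub>M M3) (\<lambda>p. clamp (e23 p))"
    unfolding clamp_def using e by auto
  from f obtain P12 P13 P23 where P:
    "AE p in M1 \<Otimes>\<^sub>M M2. P12 p" "AE p in M1 \<Otimes>\<^sub>M M3. P13 p" "AE p in M2 \<Otimes>\<^sub>M M3. P23 p"
    "\<And>x y z. P12 (x, y) \<Longrightarrow> P13 (x, z) \<Longrightarrow> P23 (y, z) \<Longrightarrow>
      f12 (x, y) + f13 (x, z) + f23 (y, z) \<le> c x y z"
    by (elim ae_feasibleE) blast
  have "ae_feasible M1 M2 M3 c (\<lambda>p. clamp (e12 p)) (\<lambda>p. clamp (e13 p)) (\<lambda>p. clamp (e23 p))"
  proof (rule ae_feasibleI[OF h P(1-3)])
    fix x y z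
    assume *: "P12 (x, y)" "P13 (x, z)" "P23 (y, z)"
    have "p12 x + p13 x + I23 \<le> m1 x" "q12 y + p23 y + I13 \<le> m2 y" "q13 z + q23 z + I12 \<le> m3 z"
      by (simp_all add: m1_def m2_def m3_def)
    \<comment> \<open>If each \<open>m\<close> equalled the conditional mean that it dominates, both
      sides would agree; a larger \<open>m\<close> only lowers the left side.\<close>
    then have "e12 (x, y) + e13 (x, z) + e23 (y, z) \<le> f12 (x, y) + f13 (x, z) + f23 (y, z)"
      using V unfolding e12_def e13_def e23_def fst_conv snd_conv by linarith
    also have "\<dots> \<le> c x y z"
      using P(4) * by blast
    finally show "clamp (e12 (x, y)) + clamp (e13 (x, z)) + clamp (e23 (y, z)) \<le> c x y z"
      using K c(2)[of x y z] unfolding clamp_def by linarith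
  qed
  moreover have "range (\<lambda>p. clamp (e12 p)) \<subseteq> {- 4 * K..2 * K}" "range (\<lambda>p. clamp (e13 p)) \<subseteq> {- 4 * K..2 * K}"
    "range (\<lambda>p. clamp (e23 p)) \<subseteq> {- 4 * K..2 * K}"
    using K by (auto simp: clamp_def)
  moreover have "4 * V - 3 * S \<le>
    dual_value M1 M2 M3 (\<lambda>p. clamp (e12 p)) (\<lambda>p. clamp (e13 p)) (\<lambda>p. clamp (e23 p))"
  proof -
    \<comment> \<open>Almost everywhere the terms are at most \<open>2 * K\<close>, so clamping can
      only raise them.\<close>
    have "integral\<^sup>L (M1 \<Otimes>\<^sub>M M2) e12 \<le> (\<integral>p. clamp (e12 p) \<partial>(M1 \<Otimes>\<^sub>M M2))"
      "integral\<^sup>L (M1 \<Otimes>\<^sub>M M3) e13 \<le> (\<integral>p. clamp (e13 p) \<partial>(M1 \<Otimes>\<^sub>M M3))"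
      "integral\<^sup>L (M2 \<Otimes>\<^sub>M M3) e23 \<le> (\<integral>p. clamp (e23 p) \<partial>(M2 \<Otimes>\<^sub>M M3))"
      using e_le by (auto intro!: integral_mono_AE e h simp: clamp_def elim!: eventually_mono)
    with e_val Im show ?thesis
      by (simp add: dual_value_def)
  qed
  ultimately show ?thesis
    unfolding V_def by blast
qed

text \<open>Convexity of the feasible set and linearity of the objective, needed to keep midpoints
  among the near-maximizers.\<close>

lemma ae_feasible_midpoint:
  assumes f: "ae_feasible M1 M2 M3 c f12 f13 f23" and g: "ae_feasible M1 M2 M3 c g12 g13 g23"
  shows "ae_feasible M1 M2 M3 c (\<lambda>p. (f12 p + g12 p) / 2) (\<lambda>p. (f13 p + g13 p) / 2) (\<lambda>p. (f23 p + g23 p) / 2)"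
    and "dual_value M1 M2 M3 (\<lambda>p. (f12 p + g12 p) / 2) (\<lambda>p. (f13 p + g13 p) / 2) (\<lambda>p. (f23 p + g23 p) / 2) =
      (dual_value M1 M2 M3 f12 f13 f23 + dual_value M1 M2 M3 g12 g13 g23) / 2"
proof -
  note i = ae_feasible_integrable[OF f] ae_feasible_integrable[OF g]
  from f obtain P12 P13 P23 where P:
    "AE p in M1 \<Otimes>\<^sub>M M2. P12 p" "AE p in M1 \<Otimes>\<^sub>M M3. P13 p" "AE p in M2 \<Otimes>\<^sub>M M3. P23 p"
    "\<And>x y z. P12 (x, y) \<Longrightarrow> P13 (x, z) \<Longrightarrow> P23 (y, z) \<Longrightarrow>
      f12 (x, y) + f13 (x, z) + f23 (y, z) \<le> c x y z"
    by (elim ae_feasibleE) blast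
  from g obtain Q12 Q13 Q23 where Q:
    "AE p in M1 \<Otimes>\<^sub>M M2. Q12 p" "AE p in M1 \<Otimes>\<^sub>M M3. Q13 p" "AE p in M2 \<Otimes>\<^sub>M M3. Q23 p"
    "\<And>x y z. Q12 (x, y) \<Longrightarrow> Q13 (x, z) \<Longrightarrow> Q23 (y, z) \<Longrightarrow>
      g12 (x, y) + g13 (x, z) + g23 (y, z) \<le> c x y z"
    by (elim ae_feasibleE) blast
  show "ae_feasible M1 M2 M3 c (\<lambda>p. (f12 p + g12 p) / 2) (\<lambda>p. (f13 p + g13 p) / 2) (\<lambda>p. (f23 p + g23 p) / 2)"
  proof (rule ae_feasibleI)
    show "AE p in M1 \<Otimes>\<^sub>M M2. P12 p \<and> Q12 p" "AE p in M1 \<Otimes>\<^sub>M M3. P13 p \<and> Q13 p"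
      "AE p in M2 \<Otimes>\<^sub>M M3. P23 p \<and> Q23 p"
      using P(1-3) Q(1-3) by auto
  next
    fix x y z
    assume "P12 (x, y) \<and> Q12 (x, y)" "P13 (x, z) \<and> Q13 (x, z)" "P23 (y, z) \<and> Q23 (y, z)"
    then show "(f12 (x, y) + g12 (x, y)) / 2 + (f13 (x, z) + g13 (x, z)) / 2 +
        (f23 (y, z) + g23 (y, z)) / 2 \<le> c x y z"
      using P(4)[of x y z] Q(4)[of x y z] by (simp add: field_simps)
  qed (use i in auto)
  show "dual_value M1 M2 M3 (\<lambda>p. (f12 p + g12 p) / 2) (\<lambda>p. (f13 p + g13 p) / 2) (\<lambda>p. (f23 p + g23 p) / 2) =
      (dual_value M1 M2 M3 f12 f13 f23 + dual_value M1 M2 M3 g12 g13 g23) / 2"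
    using i by (simp add: dual_value_def field_simps)
qed

end

section \<open>Fast Cauchy sequences in mean square\<close>

text \<open>The Hilbert space argument in abstract form, with \<open>Q\<close> as squared norm and
  \<open>D\<close> as squared distance. The infima of \<open>Q\<close> over the shrinking sets
  increase to a limit. For two near-minimizers in late sets, \<open>Q\<close> of the midpoint cannot
  fall far below that limit, so \<open>para\<close> forces them together.\<close>

lemma fast_minimizing_sequence:
  fixes C :: "nat \<Rightarrow> 'x set" and Q :: "'x \<Rightarrow> real" and D :: "'x \<Rightarrow> 'x \<Rightarrow> real"
  assumes ne: "\<And>n. C n \<noteq> {}" and anti: "decseq C"
    and mid: "\<And>n f g. f \<in> C n \<Longrightarrow> g \<in> C n \<Longrightarrow> mid f g \<in> C n"
    and nonneg: "\<And>f. 0 \<le> Q f" and bound: "\<And>n f. f \<in> C n \<Longrightarrow> Q f \<le> B"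
    and para: "\<And>n f g. f \<in> C n \<Longrightarrow> g \<in> C n \<Longrightarrow> D f g \<le> 2 * Q f + 2 * Q g - 4 * Q (mid f g)"
  shows "\<exists>u. \<forall>k. u k \<in> C k \<and> D (u k) (u (Suc k)) \<le> (1 / 4) ^ k"
proof -
  define \<phi> where "\<phi> n = Inf (Q ` C n)" for n
  have bdd: "bdd_below (Q ` C n)" for n
    using nonneg by (auto intro!: bdd_belowI[of _ 0])
  have \<phi>_le: "\<phi> n \<le> Q f" if "f \<in> C n" for n f
    unfolding \<phi>_def using that bdd by (auto intro: cINF_lower)
  have \<phi>_B: "\<phi> n \<le> B" for n
    using ne[of n] \<phi>_le bound by (meson all_not_in_conv order_trans)
  have inc: "incseq \<phi>"
    unfolding \<phi>_def using ne bdd anti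
    by (intro incseq_SucI cINF_superset_mono) (auto simp: decseq_Suc_iff)
  obtain d where d: "\<phi> \<longlonglongrightarrow> d" "\<And>n. \<phi> n \<le> d"
    using incseq_convergent[OF inc, of B] \<phi>_B by auto
  \<comment> \<open>The divisor 8 absorbs the loss below: \<open>2 * \<delta> k\<close> from each
    endpoint and \<open>4 * \<delta> k\<close> from the midpoint.\<close>
  define \<delta> :: "nat \<Rightarrow> real" where "\<delta> k = (1 / 4) ^ k / 8" for k
  have \<delta>: "0 < \<delta> k" "\<delta> (Suc k) \<le> \<delta> k" for k
    by (auto simp: \<delta>_def)
  have "\<exists>N\<ge>k. d - \<delta> k < \<phi> N" for k
  proof -
    have "\<forall>\<^sub>F n in sequentially. d - \<delta> k < \<phi> n"
      using d(1) \<delta>(1)[of k] by (intro order_tendstoD) auto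
    with eventually_ge_at_top[of k] have "\<forall>\<^sub>F n in sequentially. k \<le> n \<and> d - \<delta> k < \<phi> n"
      by eventually_elim auto
    then show ?thesis
      by (auto simp: eventually_sequentially)
  qed
  then obtain N where N: "\<And>k. k \<le> N k" "\<And>k. d - \<delta> k < \<phi> (N k)"
    by metis
  have "\<exists>f\<in>C (N k). Q f < \<phi> (N k) + \<delta> k" for k
    using cInf_lessD[of "Q ` C (N k)" "\<phi> (N k) + \<delta> k"] ne \<delta>(1)[of k] by (auto simp: \<phi>_def)
  then obtain u where u: "\<And>k. u k \<in> C (N k)" "\<And>k. Q (u k) < \<phi> (N k) + \<delta> k"
    by metis
  have "u k \<in> C k" for k
    using decseqD[OF anti N(1)[of k]] u(1)[of k] by blast
  moreover have "D (u k) (u (Suc k)) \<le> (1 / 4) ^ k" for k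
  proof -
    \<comment> \<open>The indices \<open>N k\<close> need not increase; the set with the smaller
      index contains both points, and either choice of \<open>m\<close> gives the lower bound on
      \<open>\<phi> m\<close>.\<close>
    define m where "m = min (N k) (N (Suc k))"
    have mem: "u k \<in> C m" "u (Suc k) \<in> C m"
      using u(1)[of k] u(1)[of "Suc k"] decseqD[OF anti, of m "N k"] decseqD[OF anti, of m "N (Suc k)"]
      by (auto simp: m_def)
    have "d - \<delta> k < \<phi> m"
      using N(2)[of k] N(2)[of "Suc k"] \<delta>(2)[of k] by (simp add: m_def min_def)
    also have "\<phi> m \<le> Q (mid (u k) (u (Suc k)))"
      using mem by (intro \<phi>_le mid)
    finally have "D (u k) (u (Suc k)) \<le> 8 * \<delta> k"
      using para[OF mem] u(2)[of k] u(2)[of "Suc k"] d(2)[of "N k"] d(2)[of "N (Suc k)"] \<delta>(2)[of k]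
      by linarith
    then show ?thesis
      by (simp add: \<delta>_def)
  qed
  ultimately show ?thesis
    by blast
qed

context prob_space
begin

lemma parallelogram_integral_square:
  fixes f g :: "'a \<Rightarrow> real"
  assumes [measurable]: "f \<in> borel_measurable M" "g \<in> borel_measurable M"
    and f: "\<And>x. \<bar>f x\<bar> \<le> B" and g: "\<And>x. \<bar>g x\<bar> \<le> B"
  shows "(\<integral>x. (f x - g x)\<^sup>2 \<partial>M) =
    2 * (\<integral>x. (f x)\<^sup>2 \<partial>M) + 2 * (\<integral>x. (g x)\<^sup>2 \<partial>M) - 4 * (\<integral>x. ((f x + g x) / 2)\<^sup>2 \<partial>M)"
proof -
  have B: "0 \<le> B"
    using f[of undefined] by linarith
  have sq: "integrable M (\<lambda>x. (h x)\<^sup>2)" if [measurable]: "h \<in> borel_measurable M"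
    and h: "\<And>x. \<bar>h x\<bar> \<le> B" for h :: "'a \<Rightarrow> real"
    using h B by (intro integrable_const_bound[of _ "B\<^sup>2"]) (auto simp: abs_le_square_iff[symmetric])
  have "\<bar>(f x + g x) / 2\<bar> \<le> B" for x
    using f[of x] g[of x] by (simp add: abs_le_iff)
  then have "integrable M (\<lambda>x. (f x)\<^sup>2)" "integrable M (\<lambda>x. (g x)\<^sup>2)" "integrable M (\<lambda>x. ((f x + g x) / 2)\<^sup>2)"
    using f g by (auto intro!: sq)
  moreover have "(f x - g x)\<^sup>2 = 2 * (f x)\<^sup>2 + 2 * (g x)\<^sup>2 - 4 * ((f x + g x) / 2)\<^sup>2" for x
    by (simp add: power2_eq_square field_simps)
  ultimately show ?thesis
    by simp
qed

text \<open>The mean absolute increments are bounded by a geometric series, so the sum of the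
  absolute increments has finite integral and is finite almost everywhere.\<close>

lemma AE_convergent_of_fast_Cauchy_square:
  fixes f :: "nat \<Rightarrow> 'a \<Rightarrow> real"
  assumes [measurable]: "\<And>k. f k \<in> borel_measurable M"
    and f: "\<And>k x. \<bar>f k x\<bar> \<le> B" and fast: "\<And>k. (\<integral>x. (f k x - f (Suc k) x)\<^sup>2 \<partial>M) \<le> (1 / 4) ^ k"
  shows "AE x in M. convergent (\<lambda>k. f k x)"
proof -
  define d where "d k x = f (Suc k) x - f k x" for k x
  have [measurable]: "d k \<in> borel_measurable M" for k
    unfolding d_def by measurable
  have d_bound: "\<bar>d k x\<bar> \<le> 2 * B" for k x
    using f[of k x] f[of "Suc k" x] unfolding d_def by linarith
  have int: "integrable M (d k)" for k
    using d_bound by (intro integrable_const_bound[of _ "2 * B"]) auto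
  have int2: "integrable M (\<lambda>x. (d k x)\<^sup>2)" for k
    using abs_le_square_iff[THEN iffD1, OF order_trans[OF d_bound abs_ge_self]]
    by (intro integrable_const_bound[of _ "(2 * B)\<^sup>2"]) auto
  have L1: "(\<integral>x. \<bar>d k x\<bar> \<partial>M) \<le> (1 / 2) ^ k" for k
  proof -
    \<comment> \<open>Arithmetic-geometric mean inequality; the weight \<open>2 ^ k\<close> balances
      the bound \<open>(1 / 4) ^ k\<close> on the square so that both parts become
      \<open>(1 / 2) ^ k\<close>.\<close>
    have *: "\<bar>t\<bar> \<le> (2 ^ k * t\<^sup>2 + (1 / 2) ^ k) / 2" for t :: real
    proof -
      have "0 \<le> 2 ^ k * (\<bar>t\<bar> - (1 / 2) ^ k)\<^sup>2"
        by simp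
      also have "\<dots> = 2 ^ k * t\<^sup>2 - 2 * \<bar>t\<bar> + (1 / 2) ^ k"
        by (simp add: power2_eq_square field_simps power_divide)
      finally show ?thesis
        by simp
    qed
    have "(\<integral>x. \<bar>d k x\<bar> \<partial>M) \<le> (\<integral>x. (2 ^ k * (d k x)\<^sup>2 + (1 / 2) ^ k) / 2 \<partial>M)"
      using int int2 * by (intro integral_mono) auto
    also have "\<dots> = (2 ^ k * (\<integral>x. (d k x)\<^sup>2 \<partial>M) + (1 / 2) ^ k) / 2"
      using int2 by (simp add: prob_space)
    also have "\<dots> \<le> (2 ^ k * (1 / 4) ^ k + (1 / 2) ^ k) / 2"
      using fast[of k] by (simp add: d_def power2_commute)
    also have "2 ^ k * (1 / 4 :: real) ^ k = (1 / 2) ^ k"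
      by (simp flip: power_mult_distrib)
    finally show ?thesis
      by simp
  qed
  have "(\<integral>\<^sup>+x. (\<Sum>k. ennreal \<bar>d k x\<bar>) \<partial>M) = (\<Sum>k. \<integral>\<^sup>+x. ennreal \<bar>d k x\<bar> \<partial>M)"
    by (rule nn_integral_suminf) auto
  also have "\<dots> \<le> (\<Sum>k. ennreal ((1 / 2) ^ k))"
    using L1 int by (intro suminf_le) (auto simp: nn_integral_eq_integral intro!: ennreal_leI)
  also have "\<dots> = ennreal (\<Sum>k. (1 / 2) ^ k)"
    by (intro suminf_ennreal2) auto
  finally have "(\<integral>\<^sup>+x. (\<Sum>k. ennreal \<bar>d k x\<bar>) \<partial>M) \<noteq> \<infinity>"
    by (auto simp: top_unique)
  then have "AE x in M. (\<Sum>k. ennreal \<bar>d k x\<bar>) \<noteq> \<infinity>"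
    by (intro nn_integral_PInf_AE) auto
  then show ?thesis
  proof eventually_elim
    case (elim x)
    then have "summable (\<lambda>k. \<bar>d k x\<bar>)"
      by (intro summable_suminf_not_top) auto
    then have "summable (\<lambda>k. d k x)"
      by (rule summable_rabs_cancel)
    then have "convergent (\<lambda>n. f n x - f 0 x)"
      by (simp add: summable_iff_convergent d_def sum_lessThan_telescope[of "\<lambda>n. f n x"])
    then show ?case
      by (simp add: convergent_diff_const_right_iff)
  qed
qed

lemma limit_of_fast_Cauchy_square:
  fixes f :: "nat \<Rightarrow> 'a \<Rightarrow> real"
  assumes [measurable]: "\<And>k. f k \<in> borel_measurable M" and "a \<le> b"
    and f: "\<And>k. range (f k) \<subseteq> {a..b}"
    and fast: "\<And>k. (\<integral>x. (f k x - f (Suc k) x)\<^sup>2 \<partial>M) \<le> (1 / 4) ^ k"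
  shows "\<exists>h. integrable M h \<and> range h \<subseteq> {a..b} \<and> (AE x in M. (\<lambda>k. f k x) \<longlonglongrightarrow> h x) \<and>
    (\<lambda>k. \<integral>x. f k x \<partial>M) \<longlonglongrightarrow> (\<integral>x. h x \<partial>M)"
proof -
  have ab: "a \<le> f k x" "f k x \<le> b" for k x
    using f[of k] by (auto dest: range_subsetD)
  have bound: "\<bar>f k x\<bar> \<le> \<bar>a\<bar> + \<bar>b\<bar>" for k x
    using ab[of k x] by linarith
  \<comment> \<open>The cut keeps the values in \<open>{a..b}\<close> even where the sequence
    diverges and \<open>lim\<close> is unspecified; where it converges, the cut changes
    nothing.\<close>
  define h where "h x = max a (min b (lim (\<lambda>k. f k x)))" for x
  have [measurable]: "h \<in> borel_measurable M"
    unfolding h_def by measurable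
  have lim: "AE x in M. (\<lambda>k. f k x) \<longlonglongrightarrow> h x"
    using AE_convergent_of_fast_Cauchy_square[OF assms(1) bound fast]
  proof eventually_elim
    case (elim x)
    then have L: "(\<lambda>k. f k x) \<longlonglongrightarrow> lim (\<lambda>k. f k x)"
      by (simp add: convergent_LIMSEQ_iff)
    then have "a \<le> lim (\<lambda>k. f k x)" "lim (\<lambda>k. f k x) \<le> b"
      using ab by (auto intro: LIMSEQ_le_const LIMSEQ_le_const2)
    then show ?case
      using L by (simp add: h_def)
  qed
  have "integrable M h"
    using \<open>a \<le> b\<close> by (intro integrable_const_bound[of _ "\<bar>a\<bar> + \<bar>b\<bar>"]) (auto simp: h_def)
  moreover have "range h \<subseteq> {a..b}"
    using \<open>a \<le> b\<close> by (auto simp: h_def)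
  moreover have "(\<lambda>k. \<integral>x. f k x \<partial>M) \<longlonglongrightarrow> (\<integral>x. h x \<partial>M)"
    using lim bound by (intro integral_dominated_convergence[where w = "\<lambda>_. \<bar>a\<bar> + \<bar>b\<bar>"]) auto
  ultimately show ?thesis
    using lim by blast
qed

end

section \<open>Existence of bounded solutions\<close>

context three_prob_spaces
begin

text \<open>Almost everywhere convergence on each pair space separately is what preserves the
  constraint: the exceptional sets remain null sets of pairs, as \<open>ae_feasible\<close>
  demands.\<close>

lemma bounded_maximizer_exists:
  assumes c: "\<And>x y z. c x y z \<le> K" "\<And>x y z. 0 \<le> c x y z"
  shows "\<exists>h12 h13 h23. ae_feasible M1 M2 M3 c h12 h13 h23 \<and>
    range h12 \<subseteq> {- 4 * K..2 * K} \<and> range h13 \<subseteq> {- 4 * K..2 * K} \<and> range h23 \<subseteq> {- 4 * K..2 * K} \<and>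
    (\<forall>g12 g13 g23. ae_feasible M1 M2 M3 c g12 g13 g23 \<longrightarrow>
       dual_value M1 M2 M3 g12 g13 g23 \<le> dual_value M1 M2 M3 h12 h13 h23)"
proof -
  have K: "0 \<le> K"
    using c order_trans by blast
  let ?R = "{- 4 * K..2 * K}"
  \<comment> \<open>The zero triple makes \<open>vals\<close> nonempty and later replaces a
    near-maximizer of negative value.\<close>
  have zero: "ae_feasible M1 M2 M3 c (\<lambda>_. 0) (\<lambda>_. 0) (\<lambda>_. 0)"
    by (rule ae_feasibleI[where ?P12.0 = "\<lambda>_. True" and ?P13.0 = "\<lambda>_. True" and ?P23.0 = "\<lambda>_. True"])
      (use c in auto)
  define vals where "vals = {dual_value M1 M2 M3 f12 f13 f23 | f12 f13 f23. ae_feasible M1 M2 M3 c f12 f13 f23}"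
  define S where "S = Sup vals"
  have bdd: "bdd_above vals"
    unfolding vals_def using dual_value_le[OF _ c(1)] by (auto intro!: bdd_aboveI[of _ K])
  have S: "dual_value M1 M2 M3 g12 g13 g23 \<le> S" if "ae_feasible M1 M2 M3 c g12 g13 g23" for g12 g13 g23
    unfolding S_def using that by (intro cSup_upper bdd) (auto simp: vals_def)
  define C where "C n = {(f12, f13, f23). ae_feasible M1 M2 M3 c f12 f13 f23 \<and>
    range f12 \<subseteq> ?R \<and> range f13 \<subseteq> ?R \<and> range f23 \<subseteq> ?R \<and>
    S - inverse (real (Suc n)) \<le> dual_value M1 M2 M3 f12 f13 f23}" for n
  define Q :: "('a \<times> 'b \<Rightarrow> real) \<times> ('a \<times> 'c \<Rightarrow> real) \<times> ('b \<times> 'c \<Rightarrow> real) \<Rightarrow> real"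
    where "Q = (\<lambda>(f12, f13, f23). (\<integral>p. (f12 p)\<^sup>2 \<partial>(M1 \<Otimes>\<^sub>M M2)) +
    (\<integral>p. (f13 p)\<^sup>2 \<partial>(M1 \<Otimes>\<^sub>M M3)) + (\<integral>p. (f23 p)\<^sup>2 \<partial>(M2 \<Otimes>\<^sub>M M3)))"
  define D :: "('a \<times> 'b \<Rightarrow> real) \<times> ('a \<times> 'c \<Rightarrow> real) \<times> ('b \<times> 'c \<Rightarrow> real) \<Rightarrow> _ \<Rightarrow> real"
    where "D = (\<lambda>(f12, f13, f23) (g12, g13, g23). (\<integral>p. (f12 p - g12 p)\<^sup>2 \<partial>(M1 \<Otimes>\<^sub>M M2)) +
    (\<integral>p. (f13 p - g13 p)\<^sup>2 \<partial>(M1 \<Otimes>\<^sub>M M3)) + (\<integral>p. (f23 p - g23 p)\<^sup>2 \<partial>(M2 \<Otimes>\<^sub>M M3)))"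
  define mid :: "('a \<times> 'b \<Rightarrow> real) \<times> ('a \<times> 'c \<Rightarrow> real) \<times> ('b \<times> 'c \<Rightarrow> real) \<Rightarrow> _ \<Rightarrow> _"
    where "mid = (\<lambda>(f12, f13, f23) (g12, g13, g23).
      (\<lambda>p. (f12 p + g12 p) / 2, \<lambda>p. (f13 p + g13 p) / 2, \<lambda>p. (f23 p + g23 p) / 2))"
  have abs_le: "\<bar>f p\<bar> \<le> 4 * K" if "range f \<subseteq> ?R" for f :: "'x \<Rightarrow> real" and p
  proof -
    have "f p \<in> ?R"
      using that by blast
    then show ?thesis
      using K by auto
  qed
  have "\<exists>u. \<forall>k. u k \<in> C k \<and> D (u k) (u (Suc k)) \<le> (1 / 4) ^ k"
  \<comment> \<open>The bound on \<open>Q\<close> comes from three squares of functions of modulus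
    at most \<open>4 * K\<close>, each integrated against a probability measure.\<close>
  proof (rule fast_minimizing_sequence[where Q = Q and mid = mid and B = "3 * (4 * K)\<^sup>2"])
    fix n
    \<comment> \<open>A quarter of the tolerance, since \<open>bounded_improvement\<close>
      multiplies the gap to \<open>S\<close> by 4.\<close>
    define \<epsilon> where "\<epsilon> = inverse (real (Suc n)) / 4"
    have \<epsilon>: "0 < \<epsilon>"
      by (simp add: \<epsilon>_def)
    have "\<exists>v\<in>vals. S - \<epsilon> < v"
      unfolding S_def using zero \<epsilon> by (subst less_cSup_iff[symmetric]) (auto simp: bdd, auto simp: vals_def)
    then obtain f12 f13 f23 where f: "ae_feasible M1 M2 M3 c f12 f13 f23"
      "S - \<epsilon> < dual_value M1 M2 M3 f12 f13 f23"
      by (auto simp: vals_def)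
    have "\<exists>f12 f13 f23. ae_feasible M1 M2 M3 c f12 f13 f23 \<and>
      0 \<le> dual_value M1 M2 M3 f12 f13 f23 \<and> S - \<epsilon> < dual_value M1 M2 M3 f12 f13 f23"
    proof (cases "0 \<le> dual_value M1 M2 M3 f12 f13 f23")
      case False
      moreover have "dual_value M1 M2 M3 (\<lambda>_. 0) (\<lambda>_. 0) (\<lambda>_. 0) = 0"
        by (simp add: dual_value_def)
      ultimately show ?thesis
        using zero f(2) by (intro exI[of _ "\<lambda>_. 0"]) auto
    qed (use f in blast)
    then obtain f12 f13 f23 where f: "ae_feasible M1 M2 M3 c f12 f13 f23"
      "0 \<le> dual_value M1 M2 M3 f12 f13 f23" "S - \<epsilon> < dual_value M1 M2 M3 f12 f13 f23"
      by blast
    have "\<exists>h12 h13 h23. ae_feasible M1 M2 M3 c h12 h13 h23 \<and>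
      range h12 \<subseteq> ?R \<and> range h13 \<subseteq> ?R \<and> range h23 \<subseteq> ?R \<and>
      4 * dual_value M1 M2 M3 f12 f13 f23 - 3 * S \<le> dual_value M1 M2 M3 h12 h13 h23"
      by (rule bounded_improvement[OF f(1) c _ f(2)]) (rule S)
    then obtain h12 h13 h23 where h: "ae_feasible M1 M2 M3 c h12 h13 h23"
      "range h12 \<subseteq> ?R" "range h13 \<subseteq> ?R" "range h23 \<subseteq> ?R"
      "4 * dual_value M1 M2 M3 f12 f13 f23 - 3 * S \<le> dual_value M1 M2 M3 h12 h13 h23"
      by (elim exE conjE) (rule that)
    have "S - inverse (real (Suc n)) \<le> dual_value M1 M2 M3 h12 h13 h23"
      using h(5) f(3) unfolding \<epsilon>_def by linarith
    with h have "(h12, h13, h23) \<in> C n"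
      by (simp add: C_def)
    then show "C n \<noteq> {}"
      by blast
  next
    have "C (Suc n) \<subseteq> C n" for n
    proof -
      have "inverse (real (Suc (Suc n))) \<le> inverse (real (Suc n))"
        by (intro le_imp_inverse_le) auto
      then have "S - inverse (real (Suc n)) \<le> v" if "S - inverse (real (Suc (Suc n))) \<le> v" for v
        using that by linarith
      then show ?thesis
        unfolding C_def by blast
    qed
    then show "decseq C"
      by (simp add: decseq_Suc_iff)
  next
    fix n f g
    assume "f \<in> C n" "g \<in> C n"
    then obtain f12 f13 f23 g12 g13 g23 where fg: "f = (f12, f13, f23)" "g = (g12, g13, g23)"
      and f: "ae_feasible M1 M2 M3 c f12 f13 f23" "range f12 \<subseteq> ?R" "range f13 \<subseteq> ?R" "range f23 \<subseteq> ?R"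
        "S - inverse (real (Suc n)) \<le> dual_value M1 M2 M3 f12 f13 f23"
      and g: "ae_feasible M1 M2 M3 c g12 g13 g23" "range g12 \<subseteq> ?R" "range g13 \<subseteq> ?R" "range g23 \<subseteq> ?R"
        "S - inverse (real (Suc n)) \<le> dual_value M1 M2 M3 g12 g13 g23"
      by (auto simp: C_def)
    have range_mid: "range (\<lambda>p. (f p + g p) / 2) \<subseteq> ?R" if "range f \<subseteq> ?R" "range g \<subseteq> ?R"
      for f g :: "'x \<Rightarrow> real"
    proof (rule image_subsetI)
      fix p
      have "f p \<in> ?R" "g p \<in> ?R"
        using that by blast+
      then show "(f p + g p) / 2 \<in> ?R"
        by auto
    qed
    show "mid f g \<in> C n"
      using ae_feasible_midpoint[OF f(1) g(1)] f(5) g(5) range_mid[OF f(2) g(2)] range_mid[OF f(3) g(3)]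
        range_mid[OF f(4) g(4)]
      by (simp add: C_def mid_def fg del: of_nat_Suc)
    note m = borel_measurable_integrable[OF ae_feasible_integrable(1)]
      borel_measurable_integrable[OF ae_feasible_integrable(2)]
      borel_measurable_integrable[OF ae_feasible_integrable(3)]
    show "D f g \<le> 2 * Q f + 2 * Q g - 4 * Q (mid f g)"
      unfolding D_def Q_def mid_def fg
      using P12.parallelogram_integral_square[OF m(1)[OF f(1)] m(1)[OF g(1)] abs_le[OF f(2)] abs_le[OF g(2)]]
        P13.parallelogram_integral_square[OF m(2)[OF f(1)] m(2)[OF g(1)] abs_le[OF f(3)] abs_le[OF g(3)]]
        P23.parallelogram_integral_square[OF m(3)[OF f(1)] m(3)[OF g(1)] abs_le[OF f(4)] abs_le[OF g(4)]]
      by simp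
  next
    fix n f
    assume "f \<in> C n"
    then obtain f12 f13 f23 where f: "f = (f12, f13, f23)" "range f12 \<subseteq> ?R" "range f13 \<subseteq> ?R" "range f23 \<subseteq> ?R"
      by (auto simp: C_def)
    have sq: "(f p)\<^sup>2 \<le> (4 * K)\<^sup>2" if "range f \<subseteq> ?R" for f :: "'x \<Rightarrow> real" and p
      using abs_le_square_iff[THEN iffD1, OF order_trans[OF abs_le[OF that] abs_ge_self]] .
    have le: "(\<integral>p. (f p)\<^sup>2 \<partial>M) \<le> (4 * K)\<^sup>2" if "prob_space M" "range f \<subseteq> ?R" for M and f :: "'x \<Rightarrow> real"
    proof -
      interpret prob_space M by fact
      have "(\<integral>p. (f p)\<^sup>2 \<partial>M) \<le> (\<integral>p. (4 * K)\<^sup>2 \<partial>M)"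
        using sq[OF that(2)] by (intro integral_mono') auto
      then show ?thesis
        by (simp add: prob_space)
    qed
    show "Q f \<le> 3 * (4 * K)\<^sup>2"
      using le[OF P12.prob_space_axioms f(2)] le[OF P13.prob_space_axioms f(3)]
        le[OF P23.prob_space_axioms f(4)] by (simp add: Q_def f(1))
  qed (auto simp: Q_def split: prod.split)
  then obtain u where u: "\<And>k. u k \<in> C k" "\<And>k. D (u k) (u (Suc k)) \<le> (1 / 4) ^ k"
    by blast
  define u12 where "u12 k = fst (u k)" for k
  define u13 where "u13 k = fst (snd (u k))" for k
  define u23 where "u23 k = snd (snd (u k))" for k
  have u_eq: "u k = (u12 k, u13 k, u23 k)" for k
    by (simp add: u12_def u13_def u23_def)
  have feas: "ae_feasible M1 M2 M3 c (u12 k) (u13 k) (u23 k)"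
    and range: "range (u12 k) \<subseteq> ?R" "range (u13 k) \<subseteq> ?R" "range (u23 k) \<subseteq> ?R"
    and near: "S - inverse (real (Suc k)) \<le> dual_value M1 M2 M3 (u12 k) (u13 k) (u23 k)" for k
    using u(1)[of k] unfolding u_eq C_def by blast+
  note meas = borel_measurable_integrable[OF ae_feasible_integrable(1)[OF feas]]
    borel_measurable_integrable[OF ae_feasible_integrable(2)[OF feas]]
    borel_measurable_integrable[OF ae_feasible_integrable(3)[OF feas]]
  \<comment> \<open>All three summands of \<open>D\<close> are nonnegative, so the bound on their
    sum holds for each.\<close>
  have fast: "(\<integral>p. (u12 k p - u12 (Suc k) p)\<^sup>2 \<partial>(M1 \<Otimes>\<^sub>M M2)) \<le> (1 / 4) ^ k"
    "(\<integral>p. (u13 k p - u13 (Suc k) p)\<^sup>2 \<partial>(M1 \<Otimes>\<^sub>M M3)) \<le> (1 / 4) ^ k"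
    "(\<integral>p. (u23 k p - u23 (Suc k) p)\<^sup>2 \<partial>(M2 \<Otimes>\<^sub>M M3)) \<le> (1 / 4) ^ k" for k
  proof -
    have nn: "0 \<le> (\<integral>p. (f p)\<^sup>2 \<partial>M)" for M and f :: "'x \<Rightarrow> real"
      by simp
    show "(\<integral>p. (u12 k p - u12 (Suc k) p)\<^sup>2 \<partial>(M1 \<Otimes>\<^sub>M M2)) \<le> (1 / 4) ^ k"
      "(\<integral>p. (u13 k p - u13 (Suc k) p)\<^sup>2 \<partial>(M1 \<Otimes>\<^sub>M M3)) \<le> (1 / 4) ^ k"
      "(\<integral>p. (u23 k p - u23 (Suc k) p)\<^sup>2 \<partial>(M2 \<Otimes>\<^sub>M M3)) \<le> (1 / 4) ^ k"
      using u(2)[of k] nn[of "M1 \<Otimes>\<^sub>M M2" "\<lambda>p. u12 k p - u12 (Suc k) p"]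
        nn[of "M1 \<Otimes>\<^sub>M M3" "\<lambda>p. u13 k p - u13 (Suc k) p"]
        nn[of "M2 \<Otimes>\<^sub>M M3" "\<lambda>p. u23 k p - u23 (Suc k) p"]
      unfolding u_eq D_def prod.case by linarith+
  qed
  have R: "- 4 * K \<le> 2 * K"
    using K by simp
  obtain h12 where h12: "integrable (M1 \<Otimes>\<^sub>M M2) h12" "range h12 \<subseteq> ?R"
    "AE p in M1 \<Otimes>\<^sub>M M2. (\<lambda>k. u12 k p) \<longlonglongrightarrow> h12 p"
    "(\<lambda>k. \<integral>p. u12 k p \<partial>(M1 \<Otimes>\<^sub>M M2)) \<longlonglongrightarrow> (\<integral>p. h12 p \<partial>(M1 \<Otimes>\<^sub>M M2))"
    using P12.limit_of_fast_Cauchy_square[OF meas(1) R range(1) fast(1)] by blast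
  obtain h13 where h13: "integrable (M1 \<Otimes>\<^sub>M M3) h13" "range h13 \<subseteq> ?R"
    "AE p in M1 \<Otimes>\<^sub>M M3. (\<lambda>k. u13 k p) \<longlonglongrightarrow> h13 p"
    "(\<lambda>k. \<integral>p. u13 k p \<partial>(M1 \<Otimes>\<^sub>M M3)) \<longlonglongrightarrow> (\<integral>p. h13 p \<partial>(M1 \<Otimes>\<^sub>M M3))"
    using P13.limit_of_fast_Cauchy_square[OF meas(2) R range(2) fast(2)] by blast
  obtain h23 where h23: "integrable (M2 \<Otimes>\<^sub>M M3) h23" "range h23 \<subseteq> ?R"
    "AE p in M2 \<Otimes>\<^sub>M M3. (\<lambda>k. u23 k p) \<longlonglongrightarrow> h23 p"
    "(\<lambda>k. \<integral>p. u23 k p \<partial>(M2 \<Otimes>\<^sub>M M3)) \<longlonglongrightarrow> (\<integral>p. h23 p \<partial>(M2 \<Otimes>\<^sub>M M3))"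
    using P23.limit_of_fast_Cauchy_square[OF meas(3) R range(3) fast(3)] by blast
  \<comment> \<open>Bundling the conditions on the three predicates allows one simultaneous choice
    for all \<open>k\<close>.\<close>
  define good where "good k P12 P13 P23 \<longleftrightarrow> (AE p in M1 \<Otimes>\<^sub>M M2. P12 p) \<and> (AE p in M1 \<Otimes>\<^sub>M M3. P13 p) \<and>
    (AE p in M2 \<Otimes>\<^sub>M M3. P23 p) \<and> (\<forall>x y z. P12 (x, y) \<longrightarrow> P13 (x, z) \<longrightarrow> P23 (y, z) \<longrightarrow>
      u12 k (x, y) + u13 k (x, z) + u23 k (y, z) \<le> c x y z)" for k P12 P13 P23
  have "\<exists>P12 P13 P23. good k P12 P13 P23" for k
    using feas[of k] unfolding ae_feasible_def good_def by (elim conjE)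
  then obtain P12 P13 P23 where good: "\<And>k. good k (P12 k) (P13 k) (P23 k)"
    by metis
  have P: "AE p in M1 \<Otimes>\<^sub>M M2. P12 k p" "AE p in M1 \<Otimes>\<^sub>M M3. P13 k p" "AE p in M2 \<Otimes>\<^sub>M M3. P23 k p"
    "\<And>x y z. P12 k (x, y) \<Longrightarrow> P13 k (x, z) \<Longrightarrow> P23 k (y, z) \<Longrightarrow>
       u12 k (x, y) + u13 k (x, z) + u23 k (y, z) \<le> c x y z" for k
    using good[of k] unfolding good_def by blast+
  have "ae_feasible M1 M2 M3 c h12 h13 h23"
  proof (rule ae_feasibleI[OF h12(1) h13(1) h23(1)])
    \<comment> \<open>Countably many exceptional null sets are discarded along with the set where
      convergence fails.\<close>
    show "AE p in M1 \<Otimes>\<^sub>M M2. (\<forall>k. P12 k p) \<and> (\<lambda>k. u12 k p) \<longlonglongrightarrow> h12 p"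
      "AE p in M1 \<Otimes>\<^sub>M M3. (\<forall>k. P13 k p) \<and> (\<lambda>k. u13 k p) \<longlonglongrightarrow> h13 p"
      "AE p in M2 \<Otimes>\<^sub>M M3. (\<forall>k. P23 k p) \<and> (\<lambda>k. u23 k p) \<longlonglongrightarrow> h23 p"
      using P(1-3) h12(3) h13(3) h23(3) by (auto simp: AE_all_countable)
  next
    fix x y z
    assume *: "(\<forall>k. P12 k (x, y)) \<and> (\<lambda>k. u12 k (x, y)) \<longlonglongrightarrow> h12 (x, y)"
      "(\<forall>k. P13 k (x, z)) \<and> (\<lambda>k. u13 k (x, z)) \<longlonglongrightarrow> h13 (x, z)"
      "(\<forall>k. P23 k (y, z)) \<and> (\<lambda>k. u23 k (y, z)) \<longlonglongrightarrow> h23 (y, z)"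
    then have "(\<lambda>k. u12 k (x, y) + u13 k (x, z) + u23 k (y, z)) \<longlonglongrightarrow> h12 (x, y) + h13 (x, z) + h23 (y, z)"
      by (intro tendsto_add) auto
    then show "h12 (x, y) + h13 (x, z) + h23 (y, z) \<le> c x y z"
      using * P(4) by (intro LIMSEQ_le_const2) auto
  qed
  moreover have "S \<le> dual_value M1 M2 M3 h12 h13 h23"
  proof (rule LIMSEQ_le)
    show "(\<lambda>k. S - inverse (real (Suc k))) \<longlonglongrightarrow> S"
      using tendsto_diff[OF tendsto_const[of S] LIMSEQ_inverse_real_of_nat] by simp
    show "(\<lambda>k. dual_value M1 M2 M3 (u12 k) (u13 k) (u23 k)) \<longlonglongrightarrow> dual_value M1 M2 M3 h12 h13 h23"
      unfolding dual_value_def by (intro tendsto_add h12(4) h13(4) h23(4))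
  qed (use near in blast)
  ultimately show ?thesis
    using S h12(2) h13(2) h23(2) by (meson order_trans)
qed

section \<open>Comparison of the notions of feasibility\<close>

lemma relaxed_feasible_imp_ae_feasible:
  assumes "relaxed_feasible M1 M2 M3 c f12 f13 f23"
  shows "ae_feasible M1 M2 M3 (\<lambda>x y z. c (x, y, z)) f12 f13 f23"
proof -
  from assms obtain N Y12 Y13 Y23 where f: "integrable (M1 \<Otimes>\<^sub>M M2) f12" "integrable (M1 \<Otimes>\<^sub>M M3) f13"
      "integrable (M2 \<Otimes>\<^sub>M M3) f23"
    and N: "\<And>x y z. (x, y, z) \<notin> N \<Longrightarrow> f12 (x, y) + f13 (x, z) + f23 (y, z) \<le> c (x, y, z)"
      "N \<subseteq> {(x, y, z). (x, y) \<in> Y12 \<or> (x, z) \<in> Y13 \<or> (y, z) \<in> Y23}"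
    and Y: "Y12 \<in> sets (M1 \<Otimes>\<^sub>M M2)" "measure (M1 \<Otimes>\<^sub>M M2) Y12 = 0"
      "Y13 \<in> sets (M1 \<Otimes>\<^sub>M M3)" "measure (M1 \<Otimes>\<^sub>M M3) Y13 = 0"
      "Y23 \<in> sets (M2 \<Otimes>\<^sub>M M3)" "measure (M2 \<Otimes>\<^sub>M M3) Y23 = 0"
    unfolding relaxed_feasible_def zero_thickness_def by blast
  have "Y12 \<in> null_sets (M1 \<Otimes>\<^sub>M M2)" "Y13 \<in> null_sets (M1 \<Otimes>\<^sub>M M3)" "Y23 \<in> null_sets (M2 \<Otimes>\<^sub>M M3)"
    using Y by (auto simp: null_sets_def P12.emeasure_eq_measure P13.emeasure_eq_measure P23.emeasure_eq_measure)
  then show ?thesis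
    by (intro ae_feasibleI[OF f AE_not_in AE_not_in AE_not_in] N(1)) (use N(2) in auto)
qed

text \<open>An almost-everywhere statement controls only points of the space. As the spaces are the
  whole types, the null sets cover all exceptional points, which the constraint over all
  \<open>x\<close>, \<open>y\<close>, \<open>z\<close> requires.\<close>

lemma ae_feasible_null_sets:
  assumes "ae_feasible M1 M2 M3 c f12 f13 f23"
    and "space M1 = UNIV" "space M2 = UNIV" "space M3 = UNIV"
  obtains Y12 Y13 Y23 where "Y12 \<in> null_sets (M1 \<Otimes>\<^sub>M M2)" "Y13 \<in> null_sets (M1 \<Otimes>\<^sub>M M3)"
    "Y23 \<in> null_sets (M2 \<Otimes>\<^sub>M M3)"
    "\<And>x y z. (x, y) \<notin> Y12 \<Longrightarrow> (x, z) \<notin> Y13 \<Longrightarrow> (y, z) \<notin> Y23 \<Longrightarrow>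
      f12 (x, y) + f13 (x, z) + f23 (y, z) \<le> c x y z"
proof -
  from assms(1) obtain P12 P13 P23 where P:
    "AE p in M1 \<Otimes>\<^sub>M M2. P12 p" "AE p in M1 \<Otimes>\<^sub>M M3. P13 p" "AE p in M2 \<Otimes>\<^sub>M M3. P23 p"
    "\<And>x y z. P12 (x, y) \<Longrightarrow> P13 (x, z) \<Longrightarrow> P23 (y, z) \<Longrightarrow>
      f12 (x, y) + f13 (x, z) + f23 (y, z) \<le> c x y z"
    by (elim ae_feasibleE) blast
  obtain Y12 where Y12: "Y12 \<in> null_sets (M1 \<Otimes>\<^sub>M M2)" "{p. \<not> P12 p} \<subseteq> Y12"
    using P(1) assms(2-4) by (auto simp: eventually_ae_filter space_pair_measure)
  obtain Y13 where Y13: "Y13 \<in> null_sets (M1 \<Otimes>\<^sub>M M3)" "{p. \<not> P13 p} \<subseteq> Y13"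
    using P(2) assms(2-4) by (auto simp: eventually_ae_filter space_pair_measure)
  obtain Y23 where Y23: "Y23 \<in> null_sets (M2 \<Otimes>\<^sub>M M3)" "{p. \<not> P23 p} \<subseteq> Y23"
    using P(3) assms(2-4) by (auto simp: eventually_ae_filter space_pair_measure)
  show ?thesis
    by (rule that[OF Y12(1) Y13(1) Y23(1)]) (use P(4) Y12(2) Y13(2) Y23(2) in blast)
qed

text \<open>The point is measurability in the triple product: each cylinder is the preimage of a
  measurable set under a measurable coordinate map.\<close>

lemma zero_thickness_cylinders:
  assumes "Y12 \<in> null_sets (M1 \<Otimes>\<^sub>M M2)" "Y13 \<in> null_sets (M1 \<Otimes>\<^sub>M M3)" "Y23 \<in> null_sets (M2 \<Otimes>\<^sub>M M3)"
    and "space M1 = UNIV" "space M2 = UNIV" "space M3 = UNIV"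
  shows "zero_thickness M1 M2 M3 {(x, y, z). (x, y) \<in> Y12 \<or> (x, z) \<in> Y13 \<or> (y, z) \<in> Y23}"
proof -
  have [measurable]: "Y12 \<in> sets (M1 \<Otimes>\<^sub>M M2)" "Y13 \<in> sets (M1 \<Otimes>\<^sub>M M3)" "Y23 \<in> sets (M2 \<Otimes>\<^sub>M M3)"
    using assms by auto
  have "{(x, y, z). (x, y) \<in> Y12 \<or> (x, z) \<in> Y13 \<or> (y, z) \<in> Y23} =
    {w \<in> space (M1 \<Otimes>\<^sub>M (M2 \<Otimes>\<^sub>M M3)). (fst w, fst (snd w)) \<in> Y12 \<or> (fst w, snd (snd w)) \<in> Y13 \<or> snd w \<in> Y23}"
    using assms by (auto simp: space_pair_measure)
  also have "\<dots> \<in> sets (M1 \<Otimes>\<^sub>M (M2 \<Otimes>\<^sub>M M3))"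
    by measurable
  finally show ?thesis
    unfolding zero_thickness_def using assms(1-3)
    by (intro conjI exI[of _ Y12] exI[of _ Y13] exI[of _ Y23]) (auto simp: measure_eq_0_null_sets)
qed

lemma std_feasible_imp_relaxed_feasible:
  assumes "std_feasible M1 M2 M3 c f12 f13 f23"
  shows "relaxed_feasible M1 M2 M3 c f12 f13 f23"
proof -
  have "zero_thickness M1 M2 M3 {}"
    unfolding zero_thickness_def by (auto intro!: exI[of _ "{}"])
  then show ?thesis
    using assms unfolding std_feasible_def relaxed_feasible_def by blast
qed

end

section \<open>Solutions of the relaxed and the standard problem\<close>

theorem mainTheorem16:
  fixes M1 :: "'a::polish_space measure" and M2 :: "'b::polish_space measure"
    and M3 :: "'c::polish_space measure"
    and c :: "'a \<times> 'b \<times> 'c \<Rightarrow> real"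
  assumes "prob_space M1" "sets M1 = sets borel"
    and "prob_space M2" "sets M2 = sets borel"
    and "prob_space M3" "sets M3 = sets borel"
    and "continuous_on UNIV c" "bounded (range c)" "\<And>x. c x \<ge> 0"
  shows "(\<exists>f12 f13 f23. relaxed_solution M1 M2 M3 c f12 f13 f23 \<and>
            (\<forall>p. - 17 * sup_norm c \<le> f12 p \<and> f12 p \<le> 40 / 3 * sup_norm c) \<and>
            (\<forall>p. - 17 * sup_norm c \<le> f13 p \<and> f13 p \<le> 40 / 3 * sup_norm c) \<and>
            (\<forall>p. - 17 * sup_norm c \<le> f23 p \<and> f23 p \<le> 40 / 3 * sup_norm c))
       \<and> (\<exists>f12 f13 f23. std_solution M1 M2 M3 c f12 f13 f23 \<and>
            (\<forall>p. - (80 / 3) * sup_norm c \<le> f12 p \<and> f12 p \<le> 40 / 3 * sup_norm c) \<and>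
            (\<forall>p. - (80 / 3) * sup_norm c \<le> f13 p \<and> f13 p \<le> 40 / 3 * sup_norm c) \<and>
            (\<forall>p. - (80 / 3) * sup_norm c \<le> f23 p \<and> f23 p \<le> 40 / 3 * sup_norm c))"
proof -
  interpret P1: prob_space M1 by fact
  interpret P2: prob_space M2 by fact
  interpret P3: prob_space M3 by fact
  interpret three_prob_spaces M1 M2 M3 ..
  define K where "K = sup_norm c"
  have space: "space M1 = UNIV" "space M2 = UNIV" "space M3 = UNIV"
    using assms(2,4,6) by (auto dest: sets_eq_imp_space_eq)
  obtain b where "\<And>w. \<bar>c w\<bar> \<le> b"
    using assms(8) unfolding bounded_iff by auto
  \<comment> \<open>Boundedness ensures that the supremum defining \<open>sup_norm\<close> is an
    upper bound.\<close>
  then have "bdd_above (range (\<lambda>w. \<bar>c w\<bar>))"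
    by (intro bdd_aboveI2)
  then have c_le: "c w \<le> K" for w
    unfolding K_def sup_norm_def
    by (intro order_trans[OF abs_ge_self cSUP_upper[of w UNIV "\<lambda>w. \<bar>c w\<bar>"]]) auto
  have K: "0 \<le> K"
    using c_le[of undefined] assms(9)[of undefined] by linarith
  obtain h12 h13 h23 where h: "ae_feasible M1 M2 M3 (\<lambda>x y z. c (x, y, z)) h12 h13 h23"
    "range h12 \<subseteq> {- 4 * K..2 * K}" "range h13 \<subseteq> {- 4 * K..2 * K}" "range h23 \<subseteq> {- 4 * K..2 * K}"
    and opt: "\<forall>g12 g13 g23. ae_feasible M1 M2 M3 (\<lambda>x y z. c (x, y, z)) g12 g13 g23 \<longrightarrow>
       dual_value M1 M2 M3 g12 g13 g23 \<le> dual_value M1 M2 M3 h12 h13 h23"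
    using bounded_maximizer_exists[of "\<lambda>x y z. c (x, y, z)" K, OF c_le assms(9)]
    by (elim exE conjE) (rule that)
  have bounds: "- 4 * K \<le> h12 p" "h12 p \<le> 2 * K" "- 4 * K \<le> h13 q" "h13 q \<le> 2 * K"
    "- 4 * K \<le> h23 r" "h23 r \<le> 2 * K" for p q r
    using range_subsetD[OF h(2), of p] range_subsetD[OF h(3), of q] range_subsetD[OF h(4), of r] by auto
  note i = ae_feasible_integrable[OF h(1)]
  obtain Y12 Y13 Y23 where Y: "Y12 \<in> null_sets (M1 \<Otimes>\<^sub>M M2)" "Y13 \<in> null_sets (M1 \<Otimes>\<^sub>M M3)"
    "Y23 \<in> null_sets (M2 \<Otimes>\<^sub>M M3)"
    and le: "\<And>x y z. (x, y) \<notin> Y12 \<Longrightarrow> (x, z) \<notin> Y13 \<Longrightarrow> (y, z) \<notin> Y23 \<Longrightarrow>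
      h12 (x, y) + h13 (x, z) + h23 (y, z) \<le> c (x, y, z)"
    using ae_feasible_null_sets[OF h(1) space] by blast
  have "relaxed_feasible M1 M2 M3 c h12 h13 h23"
    unfolding relaxed_feasible_def using i zero_thickness_cylinders[OF Y space] le
    by (intro conjI exI[of _ "{(x, y, z). (x, y) \<in> Y12 \<or> (x, z) \<in> Y13 \<or> (y, z) \<in> Y23}"]) auto
  \<comment> \<open>Every relaxed competitor is \<open>ae_feasible\<close>, so \<open>opt\<close>
    applies to it.\<close>
  then have relaxed: "relaxed_solution M1 M2 M3 c h12 h13 h23"
    unfolding relaxed_solution_def using opt relaxed_feasible_imp_ae_feasible by blast
  text \<open>Since \<open>- 4 * K + 2 * K + 2 * K = 0 \<le> c\<close>, the value \<open>- 4 * K\<close> on the exceptional null sets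
    makes the constraint hold everywhere.\<close>
  define s12 where "s12 p = (if p \<in> Y12 then - 4 * K else h12 p)" for p
  define s13 where "s13 p = (if p \<in> Y13 then - 4 * K else h13 p)" for p
  define s23 where "s23 p = (if p \<in> Y23 then - 4 * K else h23 p)" for p
  have ae: "AE p in M1 \<Otimes>\<^sub>M M2. h12 p = s12 p" "AE p in M1 \<Otimes>\<^sub>M M3. h13 p = s13 p"
    "AE p in M2 \<Otimes>\<^sub>M M3. h23 p = s23 p"
    using AE_not_in[OF Y(1)] AE_not_in[OF Y(2)] AE_not_in[OF Y(3)]
    by (auto simp: s12_def s13_def s23_def elim!: eventually_mono)
  note [measurable] = borel_measurable_integrable[OF i(1)] borel_measurable_integrable[OF i(2)]
    borel_measurable_integrable[OF i(3)] null_setsD2[OF Y(1)] null_setsD2[OF Y(2)] null_setsD2[OF Y(3)]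
  have [measurable]: "s12 \<in> borel_measurable (M1 \<Otimes>\<^sub>M M2)" "s13 \<in> borel_measurable (M1 \<Otimes>\<^sub>M M3)"
    "s23 \<in> borel_measurable (M2 \<Otimes>\<^sub>M M3)"
    unfolding s12_def s13_def s23_def by measurable
  have "integrable (M1 \<Otimes>\<^sub>M M2) s12" "integrable (M1 \<Otimes>\<^sub>M M3) s13" "integrable (M2 \<Otimes>\<^sub>M M3) s23"
    using i ae by (auto intro: integrable_cong_AE_imp)
  moreover have "s12 (x, y) + s13 (x, z) + s23 (y, z) \<le> c (x, y, z)" for x y z
    using le[of x y z] assms(9)[of "(x, y, z)"] bounds(1,2)[of "(x, y)"] bounds(3,4)[of "(x, z)"]
      bounds(5,6)[of "(y, z)"] K
    by (auto simp: s12_def s13_def s23_def)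
  ultimately have "std_feasible M1 M2 M3 c s12 s13 s23"
    unfolding std_feasible_def by blast
  moreover have "dual_value M1 M2 M3 s12 s13 s23 = dual_value M1 M2 M3 h12 h13 h23"
    using ae by (simp add: dual_value_def integral_cong_AE[of h12 _ s12] integral_cong_AE[of h13 _ s13]
      integral_cong_AE[of h23 _ s23])
  \<comment> \<open>Standard competitors are relaxed feasible and hence \<open>ae_feasible\<close>;
    the modified triple attains the same value as the maximizer because it differs from it only on
    null sets.\<close>
  ultimately have "std_solution M1 M2 M3 c s12 s13 s23"
    unfolding std_solution_def
    using opt relaxed_feasible_imp_ae_feasible std_feasible_imp_relaxed_feasible by fastforce
  \<comment> \<open>As \<open>K\<close> is nonnegative, \<open>{- 4 * K..2 * K}\<close> lies inside
    both required intervals.\<close>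
  moreover have "- 17 * K \<le> h12 p \<and> h12 p \<le> 40 / 3 * K" "- 17 * K \<le> h13 q \<and> h13 q \<le> 40 / 3 * K"
    "- 17 * K \<le> h23 r \<and> h23 r \<le> 40 / 3 * K"
    "- (80 / 3) * K \<le> s12 p \<and> s12 p \<le> 40 / 3 * K" "- (80 / 3) * K \<le> s13 q \<and> s13 q \<le> 40 / 3 * K"
    "- (80 / 3) * K \<le> s23 r \<and> s23 r \<le> 40 / 3 * K" for p q r
    using bounds(1,2)[of p] bounds(3,4)[of q] bounds(5,6)[of r] K by (auto simp: s12_def s13_def s23_def)
  ultimately show ?thesis
    using relaxed unfolding K_def[symmetric] by blast
qed

end
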